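(* Let $X$ be a Banach space which is uniformly convex with modulus $\eta$ and uniformly smooth with modulus $\tau$. Let $C\subseteq X$ be a closed, convex, nonempty subset. Let $b\in\mathbb N^*$ be such that for all $y\in C$, $\|y\|\le b$, and the diameter of $C$ is bounded by $b$. Let $T:C\to C$ be a pseudocontraction that is uniformly continuous with modulus $\theta$, and let $x\in C$. For all $t\in(0,1)$ let $x_t$ be the unique point in $C$ such that $x_t=tTx_t+(1-t)x$. Let $(t_n)\subseteq(0,1)$, $\alpha:\mathbb N\to\mathbb N$ and $\gamma:\mathbb N\to\mathbb N^*$ be such that: - for all $n$ and all $m\ge\alpha(n)$, $t_m\ge 1-\frac1{n+1}$; - for all $n$, $t_n\le 1-\frac1{\gamma(n)}$. Denote, for all $n$, $x_n:=x_{t_n}$. Then, for all $\varepsilon>0$ and $g:\mathbb N\to\mathbb N$ there is an $N\le\Theta_{b,\eta,\tau,\theta,\alpha,\gamma}(\varepsilon,g)$ such that for all $m,n\in[N,N+g(N)]$, $$\|x_m-x_n\|\le\varepsilon,$$ where $\Theta_{b,\eta,\tau,\theta,\alpha,\gamma}$ is the explicit functional defined in the context.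
   Context: **Notions.** $\mathbb N=\{0,1,2,\dots\}$, $\mathbb N^*=\{1,2,\dots\}$, $[N,N+g(N)]=\{N,N+1,\dots,N+g(N)\}$. Banach spaces are real. - $\eta:(0,2]\to(0,1]$ is a modulus of uniform convexity of $X$ if for all $s\in(0,2]$ and $x,y\in X$ with $\|x\|\le1$, $\|y\|\le1$, $\|x-y\|\ge s$ one has $\|\frac{x+y}2\|\le1-\eta(s)$. - $\tau:(0,\infty)\to(0,\infty)$ is a modulus of uniform smoothness of $X$ if for all $s>0$ and $x,y\in X$ with $\|x\|=1$, $\|y\|\le\tau(s)$ one has $\|x+y\|+\|x-y\|\le2+s\|y\|$. - $T:C\to C$ is a pseudocontraction if for all $x,y\in C$ and $t>0$, $t\|x-y\|\le\|(t+1)(x-y)-(Tx-Ty)\|$. - $\theta:(0,\infty)\to(0,\infty)$ is a modulus of (uniform) continuity of $T$ if for all $s>0$ and $x,y\in C$ with $\|x-y\|\le\theta(s)$ one has $\|Tx-Ty\|\le s$. - For such $T$ and $t\in(0,1)$ the point $x_t\in C$ with $x_t=tTx_t+(1-t)x$ exists and is unique. **Definition of $\Theta$.** Put $\Theta_{b,\eta,\tau,\theta,\alpha,\gamma}(\varepsilon,g):=\Theta'_{b,\eta,\tau,\theta,\alpha,\gamma}(\frac\varepsilon2,g)$, where $\Theta'_{b,\eta,\tau,\theta,\alpha,\gamma}(\varepsilon,g)$ is defined, for given $\varepsilon>0$ and $g$, as follows. *Real quantities.* For $f:\mathbb N\to\mathbb N$ let $f^M(n):=\max_{0\le i\le n}f(i)$.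 Let, for $s\in(0,2]$, $$\psi(s):=\min\left(\frac{\left(\min\left(\frac s2,\frac{s^2}{72b}\eta^2\left(\frac s{2b}\right)\right)\right)^2}4,\ \frac{s^2}{48}\eta^2\left(\frac s{2b}\right)\right),$$ and, for $s>0$, $$\omega(s):=\frac{\min(s,2)^2}{12\max(b,1)}\,\tau\left(\frac{\min(s,2)}{2\max(b,1)}\right),\qquad \tilde\theta(s):=\min\left(\frac s4,\theta\left(\frac s2\right)\right).$$ Further let $$\nu_4:=\min\left\{\frac{\varepsilon^4}{9216b^2},\ \omega\left(\frac{\varepsilon^2}{96b}\right)^2,\ \frac{\varepsilon^2}{16}\right\},\quad \delta:=\min\left\{\frac{\omega(\nu_4/(3b))}{b},\frac14\right\},\quad p:=\min\left\{\frac{\nu_4}3,\frac{\varepsilon^2}{96}\right\},$$ $$\nu_2:=\frac12\psi\left(\omega\left(\frac p{2b}\right)\right),\quad \beta(c):=\frac p{2b\gamma(c)}\ (c\in\mathbb N),\quad u:=\min\left\{\frac{2\nu_4\delta}3,\nu_2\right\},$$ $$\nu_1^*(m,n):=\frac12\min_{c\le\max(m,\,n+g^M(n))}\psi(\tilde\theta(\beta(c)))\qquad(m,n\in\mathbb N).$$ *Conventions.* $\mathcal O$ denotes a constant zero function. Let $\mathcal F$ be the set of functionals $\mathbb N\times\mathbb N\times\mathbb N^{\mathbb N}\times\mathbb N\to\mathbb N$, and $S:=\mathcal F\times\mathcal F\times\mathbb N\times\mathbb N\times\mathbb N^{\mathbb N}$; elements of $S$ are written $w=(w_1,\dots,w_5)$.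 $\Omega$ ranges over functions $S\times\mathbb N\to\mathbb N\times\mathbb N\times\mathbb N^{\mathbb N}\times\mathbb N\times\mathbb N\times\mathbb N$ with components $\Omega_1,\dots,\Omega_6$. A pair $(G,F)$ always consists of a $G$ with values in $\mathbb N\times\mathbb N\times\mathbb N^{\mathbb N}\times\mathbb N\times\mathbb N$ and an $F$ with values in $\mathbb N$, and is regarded as having 6-tuples as values. $\max$ of functions is pointwise, of tuples componentwise. $U,M$ range over functionals $\mathbb N^{\mathbb N}\times\mathbb N\times\mathbb N\to\mathbb N$. *Step 1.* For $k,n\in\mathbb N$: $$W(U,0):=\mathcal O,\quad W(U,n+1):=\lambda y.\,U(W(U,n),y,n),$$ $$J(U,M,k,0):=0,\quad J(U,M,k,n+1):=M\big(W(U,b^2(k+1)),\,J(U,M,k,n),\,b^2(k+1)\big),$$ $$\mathsf N(U,M,k):=W(U,b^2(k+1))\in\mathbb N^{\mathbb N},\qquad \mathsf T(U,M,k):=J(U,M,k,b^2(k+1))\in\mathbb N.$$ *Step 2.* For $l,i\in\mathbb N$ put $I(l):=2b^2(l+1)$ and $$(\mathbf M,\mathbf U)(\Omega,0):=(\mathcal O,\mathcal O),\quad(\mathbf M,\mathbf U)(\Omega,i+1):=\lambda p,y,L,m.\,(\Omega_5,\Omega_6)\big(\mathbf M(\Omega,i),\mathbf U(\Omega,i),p,y,L,m\big),$$ $$(\overline{\mathbf M},\overline{\mathbf U})(l,\Omega):=\lambda L,m,p.\,(\mathbf M,\mathbf U)(\Omega,I(l)+1)(p,b,L,m),$$ $$\widetilde\Psi(l,\Omega,0):=\big(\mathbf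 M(\Omega,I(l)),\ \mathbf U(\Omega,I(l)),\ 4b^2(l+1),\ b,\ \mathsf N(\overline{\mathbf U}(l,\Omega),\overline{\mathbf M}(l,\Omega),4l+3),\ \mathsf T(\overline{\mathbf U}(l,\Omega),\overline{\mathbf M}(l,\Omega),4l+3)\big),$$ $$\widetilde\Psi(l,\Omega,i+1):=\max\Big(\widetilde\Psi(l,\Omega,0),\ \big(\mathbf M(\Omega,I(l)),\mathbf U(\Omega,I(l)),\Omega_1(\widetilde\Psi(l,\Omega,i)),\dots,\Omega_4(\widetilde\Psi(l,\Omega,i))\big)\Big),$$ $$\Psi(l,\Omega):=\widetilde\Psi(l,\Omega,I(l))\in S\times\mathbb N.$$ *Step 3.* For $w,w',v\in S$, $k,k',h,l\in\mathbb N$ and $r=(r_1,r_2,r_3)\in\mathbb N^{\mathbb N}\times\mathbb N\times\mathbb N$: $$U_1(w,k)(r):=\max(r_1(k),w_2(r_3,b,r_1,r_2)),\qquad M_1(w,k)(r):=\max(k,w_1(r_3,b,r_1,r_2)).$$ Abbreviate $\mathsf N_1:=\mathsf N(U_1(w,k),M_1(w,k),\lceil4/u\rceil)$ and $\mathsf T_1:=\mathsf T(U_1(w,k),M_1(w,k),\lceil4/u\rceil)$; then $$(G_0,F_0)(w,k):=\big(b^2(\lceil4/u\rceil+1),\ b,\ \mathsf N_1,\ \mathsf T_1,\ 0,\ \mathsf N_1(k)\big),\qquad\tilde k(w,k):=k+F_0(w,k).$$ With $\nu:=\nu_1^*(\tilde k(w,k),\tilde k(w',k'))$ put $$u'(w,k,w',k'):=\min\left(\frac\nu2,\nu_2\right),\qquad\iota(w,k,w',k'):=\alpha^M\left(\left\lceil\max\left\{\frac{2b}{\sqrt{\nu}},\frac{8b^2}{\nu}\right\}\right\rceil\right).$$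 With $K_2:=\lceil4/u'(w,k,w',k')\rceil$, $\mathsf N_2:=\mathsf N(U_1(v,h),M_1(v,h),K_2)$, $\mathsf T_2:=\mathsf T(U_1(v,h),M_1(v,h),K_2)$ put $$(G_1,F_1)(w,k,w',k',v,h):=\big(b^2(K_2+1),\ b,\ \mathsf N_2,\ \mathsf T_2,\ 0,\ \mathsf N_2(h)\big).$$ Let $$U_2(w,k,v,l)(r):=\max(r_1(k),w_2(r_3,b,r_1,r_2),v_2(r_3,b,r_1,r_2)),$$ $$M_2(w,k,v,l)(r):=\max(k,w_1(r_3,b,r_1,r_2),v_1(r_3,b,r_1,r_2)).$$ With $K_3:=\lceil4/\min(u,u'(w,k,w',k'))\rceil$, $\mathsf N_3:=\mathsf N(U_2(w,k,v,l),M_2(w,k,v,l),K_3)$, $\mathsf T_3:=\mathsf T(U_2(w,k,v,l),M_2(w,k,v,l),K_3)$ put $$(G_2,F_2)(w,k,w',k',v,l):=\big(b^2(K_3+1),\ b,\ \mathsf N_3,\ \mathsf T_3,\ 0,\ \mathsf N_3(l)\big).$$ *Step 4.* For functions $\xi,\xi'$ and a pair $(G,F)$ of functions of $x=(x_1,\dots,x_6)\in(S\times\mathbb N)^3$ (so $x_1,x_3,x_5\in S$ and $x_2,x_4,x_6\in\mathbb N$) put $$\Xi(\xi,\xi')(G,F)(x):=\big(G(x_1,\dots,x_5,x_6+\xi(x)),\ \xi'(x)+F(x_1,\dots,x_5,x_6+\xi(x))\big).$$ Let $\xi_0(x):=x_6$, $\xi_1(x):=\iota(x_1,x_2,x_3,x_4)$,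 $\xi_2(x):=x_2$, $\xi_2'(x):=x_4$, and $$(\tilde G_1,\tilde F_1):=\Xi(\xi_1,\xi_1)(G_1,F_1),\quad(\tilde G_2,\tilde F_2):=\Xi(\xi_2,\xi_2)(G_2,F_2),\quad(\tilde G_3,\tilde F_3):=\Xi(\xi_2,\xi_0)(G_2,F_2),$$ $$(\tilde G_2',\tilde F_2'):=\Xi(\xi_2',\xi_2')(G_2,F_2),\quad(\tilde G_3',\tilde F_3'):=\Xi(\xi_2',\xi_0)(G_2,F_2).$$ *Step 5.* With $q\in(S\times\mathbb N)^3$ in the definitions of $(G_v,F_v)$ and $(G_{v'},F_{v'})$, with $q=(w,k,w',k')\in(S\times\mathbb N)^2$ in that of $(G_{w'},F_{w'})$, with $q\in S\times\mathbb N$ in that of $(G_w,F_w)$, and with $s\in S\times\mathbb N$: $$(G_v,F_v)(q):=\max\big((\tilde G_1,\tilde F_1)(q),(\tilde G_2,\tilde F_2)(q)\big),\quad a_v(r):=\Psi\big(\lceil1/u'(r)\rceil,\ \lambda s.(G_v,F_v)(r,s)\big)\quad(r\in(S\times\mathbb N)^2),$$ $$(G_{v'},F_{v'})(q):=\max\big((\tilde G_1,\tilde F_1)(q),(\tilde G_2',\tilde F_2')(q)\big),\quad a_{v'}(r):=\Psi\big(\lceil1/u'(r)\rceil,\ \lambda s.(G_{v'},F_{v'})(r,s)\big)\quad(r\in(S\times\mathbb N)^2),$$ $$(G_{w'},F_{w'})(q):=\max\big((G_0,F_0)(w',k'),(\tilde G_3',\tilde F_3')(q,a_{v'}(q))\big),\quad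 a_{w'}(r):=\Psi\big(\lceil1/u\rceil,\ \lambda s.(G_{w'},F_{w'})(r,s)\big)\quad(r\in S\times\mathbb N),$$ $$(G_w,F_w)(q):=\max\big((G_0,F_0)(q),(\tilde G_3,\tilde F_3)(q,a_{w'}(q),a_v(q,a_{w'}(q)))\big).$$ Finally, with $(w^\circ,k^\circ):=\Psi(\lceil1/u\rceil,(G_w,F_w))$ and $(w'^\circ,k'^\circ):=a_{w'}(w^\circ,k^\circ)$, put $$\Theta'_{b,\eta,\tau,\theta,\alpha,\gamma}(\varepsilon,g):=k'^\circ+F_0(w'^\circ,k'^\circ).$$ *)

theory Defs
  imports "HOL-Analysis.Analysis" "HOL-Library.Product_Order"
begin

definition modulus_uniform_convexity ::
  "'a::real_normed_vector itself \<Rightarrow> (real \<Rightarrow> real) \<Rightarrow> bool" where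
  "modulus_uniform_convexity X \<eta> \<longleftrightarrow>
     (\<forall>s\<in>{0<..2}. \<eta> s \<in> {0<..1} \<and>
        (\<forall>x y :: 'a. norm x \<le> 1 \<longrightarrow> norm y \<le> 1 \<longrightarrow> norm (x - y) \<ge> s \<longrightarrow>
           norm ((x + y) /\<^sub>R 2) \<le> 1 - \<eta> s))"

definition modulus_uniform_smoothness ::
  "'a::real_normed_vector itself \<Rightarrow> (real \<Rightarrow> real) \<Rightarrow> bool" where
  "modulus_uniform_smoothness X \<tau> \<longleftrightarrow>
     (\<forall>s>0. \<tau> s > 0 \<and>
        (\<forall>x y :: 'a. norm x = 1 \<longrightarrow> norm y \<le> \<tau> s \<longrightarrow>
           norm (x + y) + norm (x - y) \<le> 2 + s * norm y))"

definition pseudocontraction_on :: "'a::real_normed_vector set \<Rightarrow> ('a \<Rightarrow> 'a) \<Rightarrow> bool" where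
  "pseudocontraction_on C T \<longleftrightarrow>
     T \<in> C \<rightarrow> C \<and>
     (\<forall>x\<in>C. \<forall>y\<in>C. \<forall>t>0.
        t * norm (x - y) \<le> norm ((t + 1) *\<^sub>R (x - y) - (T x - T y)))"

definition modulus_uniform_continuity_on ::
  "'a::real_normed_vector set \<Rightarrow> ('a \<Rightarrow> 'a) \<Rightarrow> (real \<Rightarrow> real) \<Rightarrow> bool" where
  "modulus_uniform_continuity_on C T \<theta> \<longleftrightarrow>
     (\<forall>s>0. \<theta> s > 0 \<and>
        (\<forall>x\<in>C. \<forall>y\<in>C. norm (x - y) \<le> \<theta> s \<longrightarrow> norm (T x - T y) \<le> s))"

text \<open>
  Functionals on products of numbers and number functions are curried, and so are functions on
  powers of the type \<open>point\<close>. A \<open>functional\<close> takes its arguments in the order number,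
  number, function, number, whereas the arguments of a \<open>functional3\<close> are a function and two numbers.
  A pair (G, F), with G having quintuples as values, is one function into flat 6-tuples whose last
  component is F.

  A maximum of tuples is \<^const>\<open>sup\<close>: by the instances in Product_Order it is componentwise on tuples,
  it is pointwise on functions, and it is the usual maximum on numbers.
\<close>

type_synonym functional = "nat \<Rightarrow> nat \<Rightarrow> (nat \<Rightarrow> nat) \<Rightarrow> nat \<Rightarrow> nat"
type_synonym quint = "functional \<times> functional \<times> nat \<times> nat \<times> (nat \<Rightarrow> nat)"
type_synonym point = "quint \<times> nat"
type_synonym six = "nat \<times> nat \<times> (nat \<Rightarrow> nat) \<times> nat \<times> nat \<times> nat"
type_synonym functional3 = "(nat \<Rightarrow> nat) \<Rightarrow> nat \<Rightarrow> nat \<Rightarrow> nat"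

definition running_max :: "(nat \<Rightarrow> nat) \<Rightarrow> nat \<Rightarrow> nat" where
  "running_max f n = Max (f ` {..n})"

definition first_functional :: "quint \<Rightarrow> functional" where
  "first_functional w = fst w"

definition second_functional :: "quint \<Rightarrow> functional" where
  "second_functional w = fst (snd w)"

definition six5 :: "six \<Rightarrow> nat" where
  "six5 z = (case z of (z1, z2, z3, z4, z5, z6) \<Rightarrow> z5)"

definition six6 :: "six \<Rightarrow> nat" where
  "six6 z = (case z of (z1, z2, z3, z4, z5, z6) \<Rightarrow> z6)"

primrec W :: "functional3 \<Rightarrow> nat \<Rightarrow> nat \<Rightarrow> nat" where
  "W U 0 = (\<lambda>_. 0)"
| "W U (Suc n) = (\<lambda>y. U (W U n) y n)"

primrec MU :: "(point \<Rightarrow> six) \<Rightarrow> nat \<Rightarrow> functional \<times> functional" where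
  "MU Om 0 = ((\<lambda>_ _ _ _. 0), (\<lambda>_ _ _ _. 0))"
| "MU Om (Suc i) =
     ((\<lambda>p y L m. six5 (Om ((fst (MU Om i), snd (MU Om i), p, y, L), m))),
      (\<lambda>p y L m. six6 (Om ((fst (MU Om i), snd (MU Om i), p, y, L), m))))"

definition Xi ::
  "(point \<Rightarrow> point \<Rightarrow> point \<Rightarrow> nat) \<Rightarrow> (point \<Rightarrow> point \<Rightarrow> point \<Rightarrow> nat) \<Rightarrow>
   (point \<Rightarrow> point \<Rightarrow> point \<Rightarrow> six) \<Rightarrow> point \<Rightarrow> point \<Rightarrow> point \<Rightarrow> six" where
  "Xi \<xi> \<xi>' GF x y z =
     (case GF x y (fst z, snd z + \<xi> x y z) of
        (g1, g2, g3, g4, g5, f) \<Rightarrow> (g1, g2, g3, g4, g5, \<xi>' x y z + f))"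

locale metastability_rate =
  fixes b :: nat
    and \<eta> \<tau> \<theta> :: "real \<Rightarrow> real"
    and \<alpha> \<gamma> :: "nat \<Rightarrow> nat"
    and \<epsilon> :: real
    and g :: "nat \<Rightarrow> nat"
begin

text \<open>
  The functions \<open>\<eta>\<close>, \<open>\<tau>\<close> and \<open>\<theta>\<close> are total; only their values on \<open>(0,2]\<close>, respectively \<open>(0,\<infinity>)\<close>, are
  constrained in the predicates above. Exponents on a function symbol denote powers of its value.
\<close>

definition psi :: "real \<Rightarrow> real" where
  "psi s = min
     ((min (s / 2) (s\<^sup>2 / (72 * real b) * (\<eta> (s / (2 * real b)))\<^sup>2))\<^sup>2 / 4)
     (s\<^sup>2 / 48 * (\<eta> (s / (2 * real b)))\<^sup>2)"

definition omega :: "real \<Rightarrow> real" where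
  "omega s = (min s 2)\<^sup>2 / (12 * max (real b) 1) * \<tau> (min s 2 / (2 * max (real b) 1))"

definition theta_tilde :: "real \<Rightarrow> real" where
  "theta_tilde s = min (s / 4) (\<theta> (s / 2))"

definition nu4 :: real where
  "nu4 = Min {\<epsilon> ^ 4 / (9216 * (real b)\<^sup>2), (omega (\<epsilon>\<^sup>2 / (96 * real b)))\<^sup>2, \<epsilon>\<^sup>2 / 16}"

definition delta :: real where
  "delta = min (omega (nu4 / (3 * real b)) / real b) (1 / 4)"

definition p0 :: real where
  "p0 = min (nu4 / 3) (\<epsilon>\<^sup>2 / 96)"

definition nu2 :: real where
  "nu2 = 1 / 2 * psi (omega (p0 / (2 * real b)))"

definition beta :: "nat \<Rightarrow> real" where
  "beta c = p0 / (2 * real b * real (\<gamma> c))"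

definition u0 :: real where
  "u0 = min (2 * nu4 * delta / 3) nu2"

definition nu1_star :: "nat \<Rightarrow> nat \<Rightarrow> real" where
  "nu1_star m n =
     1 / 2 * Min ((\<lambda>c. psi (theta_tilde (beta c))) ` {..max m (n + running_max g n)})"

primrec J :: "functional3 \<Rightarrow> functional3 \<Rightarrow> nat \<Rightarrow> nat \<Rightarrow> nat" where
  "J U M k 0 = 0"
| "J U M k (Suc n) = M (W U (b\<^sup>2 * (k + 1))) (J U M k n) (b\<^sup>2 * (k + 1))"

definition NN :: "functional3 \<Rightarrow> functional3 \<Rightarrow> nat \<Rightarrow> nat \<Rightarrow> nat" where
  "NN U M k = W U (b\<^sup>2 * (k + 1))"

definition TT :: "functional3 \<Rightarrow> functional3 \<Rightarrow> nat \<Rightarrow> nat" where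
  "TT U M k = J U M k (b\<^sup>2 * (k + 1))"

definition I :: "nat \<Rightarrow> nat" where
  "I l = 2 * b\<^sup>2 * (l + 1)"

definition M_bar :: "nat \<Rightarrow> (point \<Rightarrow> six) \<Rightarrow> functional3" where
  "M_bar l Om = (\<lambda>L m p. fst (MU Om (I l + 1)) p b L m)"

definition U_bar :: "nat \<Rightarrow> (point \<Rightarrow> six) \<Rightarrow> functional3" where
  "U_bar l Om = (\<lambda>L m p. snd (MU Om (I l + 1)) p b L m)"

definition Psi_start :: "nat \<Rightarrow> (point \<Rightarrow> six) \<Rightarrow> point" where
  "Psi_start l Om =
     ((fst (MU Om (I l)), snd (MU Om (I l)), 4 * b\<^sup>2 * (l + 1), b,
       NN (U_bar l Om) (M_bar l Om) (4 * l + 3)),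
      TT (U_bar l Om) (M_bar l Om) (4 * l + 3))"

primrec Psi_tilde :: "nat \<Rightarrow> (point \<Rightarrow> six) \<Rightarrow> nat \<Rightarrow> point" where
  "Psi_tilde l Om 0 = Psi_start l Om"
| "Psi_tilde l Om (Suc i) =
     sup (Psi_start l Om)
       (case Om (Psi_tilde l Om i) of
          (o1, o2, o3, o4, o5, o6) \<Rightarrow>
            ((fst (MU Om (I l)), snd (MU Om (I l)), o1, o2, o3), o4))"

definition Psi :: "nat \<Rightarrow> (point \<Rightarrow> six) \<Rightarrow> point" where
  "Psi l Om = Psi_tilde l Om (I l)"

definition U1 :: "point \<Rightarrow> functional3" where
  "U1 x = (\<lambda>r1 r2 r3. max (r1 (snd x)) (second_functional (fst x) r3 b r1 r2))"

definition M1 :: "point \<Rightarrow> functional3" where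
  "M1 x = (\<lambda>r1 r2 r3. max (snd x) (first_functional (fst x) r3 b r1 r2))"

definition GF0 :: "point \<Rightarrow> six" where
  "GF0 x =
     (let K = nat \<lceil>4 / u0\<rceil>; N1 = NN (U1 x) (M1 x) K; T1 = TT (U1 x) (M1 x) K
      in (b\<^sup>2 * (K + 1), b, N1, T1, 0, N1 (snd x)))"

definition k_tilde :: "point \<Rightarrow> nat" where
  "k_tilde x = snd x + six6 (GF0 x)"

definition u' :: "point \<Rightarrow> point \<Rightarrow> real" where
  "u' x y = min (nu1_star (k_tilde x) (k_tilde y) / 2) nu2"

definition iota :: "point \<Rightarrow> point \<Rightarrow> nat" where
  "iota x y =
     (let \<nu> = nu1_star (k_tilde x) (k_tilde y)
      in running_max \<alpha> (nat \<lceil>max (2 * real b / sqrt \<nu>) (8 * (real b)\<^sup>2 / \<nu>)\<rceil>))"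

definition GF1 :: "point \<Rightarrow> point \<Rightarrow> point \<Rightarrow> six" where
  "GF1 x y z =
     (let K = nat \<lceil>4 / u' x y\<rceil>; N2 = NN (U1 z) (M1 z) K; T2 = TT (U1 z) (M1 z) K
      in (b\<^sup>2 * (K + 1), b, N2, T2, 0, N2 (snd z)))"

definition U2 :: "point \<Rightarrow> point \<Rightarrow> functional3" where
  "U2 x z = (\<lambda>r1 r2 r3.
     Max {r1 (snd x), second_functional (fst x) r3 b r1 r2, second_functional (fst z) r3 b r1 r2})"

definition M2 :: "point \<Rightarrow> point \<Rightarrow> functional3" where
  "M2 x z = (\<lambda>r1 r2 r3.
     Max {snd x, first_functional (fst x) r3 b r1 r2, first_functional (fst z) r3 b r1 r2})"

definition GF2 :: "point \<Rightarrow> point \<Rightarrow> point \<Rightarrow> six" where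
  "GF2 x y z =
     (let K = nat \<lceil>4 / min u0 (u' x y)\<rceil>; N3 = NN (U2 x z) (M2 x z) K; T3 = TT (U2 x z) (M2 x z) K
      in (b\<^sup>2 * (K + 1), b, N3, T3, 0, N3 (snd z)))"

definition xi0 :: "point \<Rightarrow> point \<Rightarrow> point \<Rightarrow> nat" where
  "xi0 x y z = snd z"

definition xi1 :: "point \<Rightarrow> point \<Rightarrow> point \<Rightarrow> nat" where
  "xi1 x y z = iota x y"

definition xi2 :: "point \<Rightarrow> point \<Rightarrow> point \<Rightarrow> nat" where
  "xi2 x y z = snd x"

definition xi2' :: "point \<Rightarrow> point \<Rightarrow> point \<Rightarrow> nat" where
  "xi2' x y z = snd y"

definition GF1_tilde :: "point \<Rightarrow> point \<Rightarrow> point \<Rightarrow> six" where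
  "GF1_tilde = Xi xi1 xi1 GF1"

definition GF2_tilde :: "point \<Rightarrow> point \<Rightarrow> point \<Rightarrow> six" where
  "GF2_tilde = Xi xi2 xi2 GF2"

definition GF3_tilde :: "point \<Rightarrow> point \<Rightarrow> point \<Rightarrow> six" where
  "GF3_tilde = Xi xi2 xi0 GF2"

definition GF2_tilde' :: "point \<Rightarrow> point \<Rightarrow> point \<Rightarrow> six" where
  "GF2_tilde' = Xi xi2' xi2' GF2"

definition GF3_tilde' :: "point \<Rightarrow> point \<Rightarrow> point \<Rightarrow> six" where
  "GF3_tilde' = Xi xi2' xi0 GF2"

definition GF_v :: "point \<Rightarrow> point \<Rightarrow> point \<Rightarrow> six" where
  "GF_v x y z = sup (GF1_tilde x y z) (GF2_tilde x y z)"

definition a_v :: "point \<Rightarrow> point \<Rightarrow> point" where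
  "a_v x y = Psi (nat \<lceil>1 / u' x y\<rceil>) (\<lambda>s. GF_v x y s)"

definition GF_v' :: "point \<Rightarrow> point \<Rightarrow> point \<Rightarrow> six" where
  "GF_v' x y z = sup (GF1_tilde x y z) (GF2_tilde' x y z)"

definition a_v' :: "point \<Rightarrow> point \<Rightarrow> point" where
  "a_v' x y = Psi (nat \<lceil>1 / u' x y\<rceil>) (\<lambda>s. GF_v' x y s)"

definition GF_w' :: "point \<Rightarrow> point \<Rightarrow> six" where
  "GF_w' x y = sup (GF0 y) (GF3_tilde' x y (a_v' x y))"

definition a_w' :: "point \<Rightarrow> point" where
  "a_w' x = Psi (nat \<lceil>1 / u0\<rceil>) (\<lambda>s. GF_w' x s)"

definition GF_w :: "point \<Rightarrow> six" where
  "GF_w x = sup (GF0 x) (GF3_tilde x (a_w' x) (a_v x (a_w' x)))"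

definition Theta' :: nat where
  "Theta' =
     (let w_circ = Psi (nat \<lceil>1 / u0\<rceil>) GF_w; w'_circ = a_w' w_circ
      in snd w'_circ + six6 (GF0 w'_circ))"

end

definition Theta ::
  "nat \<Rightarrow> (real \<Rightarrow> real) \<Rightarrow> (real \<Rightarrow> real) \<Rightarrow> (real \<Rightarrow> real) \<Rightarrow> (nat \<Rightarrow> nat) \<Rightarrow> (nat \<Rightarrow> nat) \<Rightarrow>
   real \<Rightarrow> (nat \<Rightarrow> nat) \<Rightarrow> nat" where
  "Theta b \<eta> \<tau> \<theta> \<alpha> \<gamma> \<epsilon> g = metastability_rate.Theta' b \<eta> \<tau> \<theta> \<alpha> \<gamma> (\<epsilon> / 2) g"

end

theory Submission
  imports Defs
begin

text \<open>
  Let \<open>V S\<close> be the infimum over \<open>y \<in> C\<close> of \<open>max\<^bsub>n \<in> S\<^esub> \<parallel>X n - y\<parallel>\<^sup>2\<close> for a finite segment \<open>S\<close> of indices. If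
  \<open>V\<close> hardly drops when a segment \<open>B\<close> is replaced by an initial part \<open>A\<close> or by a late part \<open>E\<close>, then by
  uniform convexity an approximate centre \<open>w\<close> of \<open>B\<close> is close to an approximate centre \<open>v\<close> of \<open>E\<close>. The latter
  is almost fixed by \<open>T\<close>, because the residuals \<open>X n - T (X n)\<close> are tiny on \<open>E\<close>; accretivity of \<open>I - T\<close> then
  gives \<open>\<langle>X j - x, J (X j - w)\<rangle> \<lesssim> 0\<close> for all indices \<open>j\<close> up to some horizon. Moving \<open>w\<close> towards the anchor
  \<open>x\<close> and using smoothness gives \<open>\<langle>x - w, J (X c - w)\<rangle> \<lesssim> 0\<close> for some \<open>c \<in> A\<close>, hence \<open>X c\<close> is close to \<open>w\<close>.
  If metastability failed, the same could be done with a sequence \<open>X (h n)\<close>, \<open>n \<le> h n \<le> n + g n\<close>, that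
  stays away from \<open>X c\<close>; the two sets of inequalities force both centres to agree, a contradiction.

  Of the rate, only the functionals \<open>U\<close> belonging to \<open>(G_w, F_w)\<close> matter: their values \<open>seg i m\<close> at level \<open>i\<close>
  are lengths of segments \<open>[m, m + seg i m]\<close> that contain \<open>A\<close> and \<open>E\<close> of level \<open>i - 1\<close>. There are
  twice as many levels as \<open>V\<close> can drop, so that the lower half is left for the second sequence, whose segments are
  taken between \<open>A\<close> and \<open>E\<close> of the first one.
\<close>

subsection \<open>The duality map of a smooth space\<close>

text \<open>
  \<open>dual x h\<close> is the value at \<open>h\<close> of the normalized duality map at \<open>x\<close>, obtained as the one-sided derivative of
  half the squared norm; smoothness makes it linear in \<open>h\<close>, so that Hahn-Banach is not needed.
\<close>

definition dual_quotient :: "'a::real_normed_vector \<Rightarrow> 'a \<Rightarrow> real \<Rightarrow> real" where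
  "dual_quotient x h t = ((norm (x + t *\<^sub>R h))\<^sup>2 - (norm x)\<^sup>2) / (2 * t)"

definition dual :: "'a::real_normed_vector \<Rightarrow> 'a \<Rightarrow> real" where
  "dual x h = (INF t\<in>{0<..}. dual_quotient x h t)"

lemma norm_convex_square:
  fixes x y :: "'a::real_normed_vector"
  assumes "0 \<le> l" "l \<le> 1"
  shows "(norm ((1 - l) *\<^sub>R x + l *\<^sub>R y))\<^sup>2 \<le> (1 - l) * (norm x)\<^sup>2 + l * (norm y)\<^sup>2"
proof -
  have "norm ((1 - l) *\<^sub>R x + l *\<^sub>R y) \<le> (1 - l) * norm x + l * norm y"
    using norm_triangle_ineq[of "(1 - l) *\<^sub>R x" "l *\<^sub>R y"] assms by simp
  then have "(norm ((1 - l) *\<^sub>R x + l *\<^sub>R y))\<^sup>2 \<le> ((1 - l) * norm x + l * norm y)\<^sup>2"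
    by (intro power_mono) auto
  also have "\<dots> = (1 - l) * (norm x)\<^sup>2 + l * (norm y)\<^sup>2 - l * (1 - l) * (norm x - norm y)\<^sup>2"
    by (simp add: power2_eq_square algebra_simps)
  also have "\<dots> \<le> (1 - l) * (norm x)\<^sup>2 + l * (norm y)\<^sup>2"
    using assms by simp
  finally show ?thesis .
qed

text \<open>A lower bound independent of \<open>t\<close> makes the infimum in \<open>dual\<close>
  meaningful.\<close>

lemma dual_quotient_lower:
  assumes "0 < t"
  shows "- (norm x * norm h) \<le> dual_quotient x h t"
proof -
  have *: "norm x - t * norm h \<le> norm (x + t *\<^sub>R h)"
    using norm_triangle_ineq2[of x "- (t *\<^sub>R h)"] assms by simp
  have "(norm x)\<^sup>2 - 2 * t * (norm x * norm h) \<le> (norm (x + t *\<^sub>R h))\<^sup>2"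
  proof (cases "norm x - t * norm h \<ge> 0")
    case True
    then have "(norm x - t * norm h)\<^sup>2 \<le> (norm (x + t *\<^sub>R h))\<^sup>2"
      using * by (intro power_mono)
    moreover have "(norm x - t * norm h)\<^sup>2 = (norm x)\<^sup>2 - 2 * t * (norm x * norm h) + (t * norm h)\<^sup>2"
      by (simp add: power2_eq_square algebra_simps)
    ultimately show ?thesis using zero_le_power2[of "t * norm h"] by linarith
  next
    \<comment> \<open>The reverse triangle inequality cannot be squared here, but then the left-hand
      side is nonpositive.\<close>
    case False
    then have "norm x * norm x \<le> norm x * (t * norm h)"
      by (intro mult_left_mono) auto
    moreover have "0 \<le> (norm (x + t *\<^sub>R h))\<^sup>2" "0 \<le> norm x * norm x" by auto
    moreover have "norm x * norm x = (norm x)\<^sup>2" by (simp add: power2_eq_square)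
    moreover have "2 * t * (norm x * norm h) = 2 * (norm x * (t * norm h))" by simp
    ultimately show ?thesis by linarith
  qed
  then show ?thesis
    using assms by (simp add: dual_quotient_def field_simps)
qed

lemma dual_quotient_bdd: "bdd_below (dual_quotient x h ` {0<..})"
  using dual_quotient_lower by (force intro!: bdd_belowI)

lemma dual_le_quotient:
  assumes "0 < t"
  shows "dual x h \<le> dual_quotient x h t"
  unfolding dual_def using assms by (intro cINF_lower dual_quotient_bdd) simp

lemma dual_greatest:
  assumes "\<And>t. 0 < t \<Longrightarrow> c \<le> dual_quotient x h t"
  shows "c \<le> dual x h"
  unfolding dual_def using assms by (intro cINF_greatest) (auto intro: gt_ex)

text \<open>Convexity of the squared norm on the segment from \<open>x\<close> to
  \<open>x + t *\<^sub>R h\<close>. Hence the infimum in \<open>dual\<close> can be approximated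
  with arbitrarily small \<open>t\<close>.\<close>

lemma dual_quotient_mono:
  assumes "0 < s" "s \<le> t"
  shows "dual_quotient x h s \<le> dual_quotient x h t"
proof -
  define l where "l = s / t"
  have l: "0 \<le> l" "l \<le> 1" using assms by (auto simp: l_def)
  have "x + s *\<^sub>R h = (1 - l) *\<^sub>R x + l *\<^sub>R (x + t *\<^sub>R h)"
    using assms by (simp add: l_def algebra_simps)
  then have "(norm (x + s *\<^sub>R h))\<^sup>2 \<le> (1 - l) * (norm x)\<^sup>2 + l * (norm (x + t *\<^sub>R h))\<^sup>2"
    using norm_convex_square[OF l] by metis
  then have "(norm (x + s *\<^sub>R h))\<^sup>2 - (norm x)\<^sup>2 \<le> l * ((norm (x + t *\<^sub>R h))\<^sup>2 - (norm x)\<^sup>2)"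
    by (simp add: algebra_simps)
  then have "dual_quotient x h s \<le> l * ((norm (x + t *\<^sub>R h))\<^sup>2 - (norm x)\<^sup>2) / (2 * s)"
    using assms unfolding dual_quotient_def by (intro divide_right_mono) auto
  also have "\<dots> = dual_quotient x h t"
    using assms by (simp add: dual_quotient_def l_def)
  finally show ?thesis .
qed

lemma dual_quotient_near:
  assumes "0 < e"
  obtains t where "0 < t" "\<And>s. 0 < s \<Longrightarrow> s \<le> t \<Longrightarrow> dual_quotient x h s < dual x h + e"
proof -
  have "\<not> dual x h + e \<le> dual x h" using assms by simp
  then obtain t where "0 < t" "dual_quotient x h t < dual x h + e"
    using dual_greatest[of "dual x h + e" x h] by (meson not_le)
  then show ?thesis using that dual_quotient_mono by (meson le_less_trans)
qed

text \<open>Stepping by \<open>t / 2\<close> along \<open>h + k\<close> leads to the midpoint of the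
  steps by \<open>t\<close> along \<open>h\<close> and along \<open>k\<close>; monotonicity allows
  one small \<open>t\<close> for both quotients.\<close>

lemma dual_subadditive: "dual x (h + k) \<le> dual x h + dual x k"
proof (rule field_le_epsilon)
  fix e :: real assume "0 < e"
  then have e: "0 < e / 2" by simp
  obtain t1 where t1: "0 < t1" "\<And>s. 0 < s \<Longrightarrow> s \<le> t1 \<Longrightarrow> dual_quotient x h s < dual x h + e / 2"
    using dual_quotient_near[OF e] by blast
  obtain t2 where t2: "0 < t2" "\<And>s. 0 < s \<Longrightarrow> s \<le> t2 \<Longrightarrow> dual_quotient x k s < dual x k + e / 2"
    using dual_quotient_near[OF e] by blast
  define t where "t = min t1 t2"
  have t: "0 < t" using t1 t2 by (simp add: t_def)
  have "x + (t / 2) *\<^sub>R (h + k) = (1 - 1/2) *\<^sub>R (x + t *\<^sub>R h) + (1/2) *\<^sub>R (x + t *\<^sub>R k)"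
    by (simp add: algebra_simps flip: scaleR_add_left)
  then have *: "(norm (x + (t / 2) *\<^sub>R (h + k)))\<^sup>2
      \<le> (1 - 1/2) * (norm (x + t *\<^sub>R h))\<^sup>2 + 1/2 * (norm (x + t *\<^sub>R k))\<^sup>2"
    using norm_convex_square[of "1/2" "x + t *\<^sub>R h" "x + t *\<^sub>R k"] by simp
  then have "dual_quotient x (h + k) (t / 2) \<le> dual_quotient x h t + dual_quotient x k t"
  proof -
    have "4 * A - 4 * X \<le> 2 * (B - X) + 2 * (D - X) \<Longrightarrow>
        (A - X) / (2 * (t / 2)) \<le> (B - X) / (2 * t) + (D - X) / (2 * t)" for A B D X :: real
      using t by (simp add: divide_simps)
    then show ?thesis
      unfolding dual_quotient_def using * by simp
  qed
  moreover have "dual x (h + k) \<le> dual_quotient x (h + k) (t / 2)"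
    using t by (intro dual_le_quotient) simp
  ultimately show "dual x (h + k) \<le> dual x h + dual x k + e"
    using t1(2)[of t] t2(2)[of t] t by (simp add: t_def)
qed

lemma dual_scale_pos:
  assumes "0 < c"
  shows "dual x (c *\<^sub>R h) = c * dual x h"
proof (rule antisym)
  have le: "dual x (c *\<^sub>R h) \<le> c * dual x h" if "0 < c" for c h
  proof -
    have "dual x (c *\<^sub>R h) / c \<le> dual_quotient x h t" if "0 < t" for t
    proof -
      have "dual x (c *\<^sub>R h) \<le> dual_quotient x (c *\<^sub>R h) (t / c)"
        using \<open>0 < c\<close> \<open>0 < t\<close> by (intro dual_le_quotient) simp
      also have "\<dots> = c * dual_quotient x h t"
        using \<open>0 < c\<close> by (simp add: dual_quotient_def)
      finally show ?thesis using \<open>0 < c\<close> by (simp add: field_simps)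
    qed
    then have "dual x (c *\<^sub>R h) / c \<le> dual x h" by (rule dual_greatest)
    then show ?thesis using \<open>0 < c\<close> by (simp add: field_simps)
  qed
  show "dual x (c *\<^sub>R h) \<le> c * dual x h" using le assms .
  have "dual x (inverse c *\<^sub>R (c *\<^sub>R h)) \<le> inverse c * dual x (c *\<^sub>R h)"
    using assms by (intro le) simp
  then show "c * dual x h \<le> dual x (c *\<^sub>R h)" using assms by (simp add: field_simps)
qed

lemma dual_scale_left:
  assumes "0 < c"
  shows "dual (c *\<^sub>R x) h = c * dual x h"
proof (rule antisym)
  have le: "dual (c *\<^sub>R x) h \<le> c * dual x h" if "0 < c" for c x
  proof -
    have "dual (c *\<^sub>R x) h / c \<le> dual_quotient x h t" if "0 < t" for t
    proof -
      have "c *\<^sub>R x + (c * t) *\<^sub>R h = c *\<^sub>R (x + t *\<^sub>R h)" by (simp add: algebra_simps)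
      then have "norm (c *\<^sub>R x + (c * t) *\<^sub>R h) = c * norm (x + t *\<^sub>R h)"
        using \<open>0 < c\<close> by simp
      then have "dual_quotient (c *\<^sub>R x) h (c * t) = c * dual_quotient x h t"
        using \<open>0 < c\<close> \<open>0 < t\<close>
        by (simp add: dual_quotient_def power_mult_distrib power2_eq_square field_simps)
      moreover have "dual (c *\<^sub>R x) h \<le> dual_quotient (c *\<^sub>R x) h (c * t)"
        using \<open>0 < c\<close> \<open>0 < t\<close> by (intro dual_le_quotient) simp
      ultimately show ?thesis using \<open>0 < c\<close> by (simp add: field_simps)
    qed
    then have "dual (c *\<^sub>R x) h / c \<le> dual x h" by (rule dual_greatest)
    then show ?thesis using \<open>0 < c\<close> by (simp add: field_simps)
  qed
  show "dual (c *\<^sub>R x) h \<le> c * dual x h" using le assms .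
  have "dual (inverse c *\<^sub>R (c *\<^sub>R x)) h \<le> inverse c * dual (c *\<^sub>R x) h"
    using assms by (intro le) simp
  then show "c * dual x h \<le> dual (c *\<^sub>R x) h" using assms by (simp add: field_simps)
qed

lemma dual_le_norm: "dual x h \<le> norm x * norm h"
proof (rule field_le_epsilon)
  fix e :: real assume "0 < e"
  define t where "t = 2 * e / ((norm h)\<^sup>2 + 1)"
  have pos: "0 < (norm h)\<^sup>2 + 1" by (simp add: add_nonneg_pos)
  have t: "0 < t" using \<open>0 < e\<close> pos by (simp add: t_def)
  have "norm (x + t *\<^sub>R h) \<le> norm x + t * norm h"
    using norm_triangle_ineq[of x "t *\<^sub>R h"] t by simp
  then have "(norm (x + t *\<^sub>R h))\<^sup>2 \<le> (norm x + t * norm h)\<^sup>2"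
    by (intro power_mono) auto
  then have "dual_quotient x h t \<le> ((norm x + t * norm h)\<^sup>2 - (norm x)\<^sup>2) / (2 * t)"
    using t unfolding dual_quotient_def by (intro divide_right_mono) auto
  also have "\<dots> = norm x * norm h + t * (norm h)\<^sup>2 / 2"
    using t by (simp add: power2_eq_square field_simps)
  finally have "dual_quotient x h t \<le> norm x * norm h + t * (norm h)\<^sup>2 / 2" .
  moreover have "t * (norm h)\<^sup>2 \<le> t * ((norm h)\<^sup>2 + 1)" using t by simp
  moreover have "t * ((norm h)\<^sup>2 + 1) = 2 * e" using pos by (simp add: t_def)
  ultimately show "dual x h \<le> norm x * norm h + e"
    using dual_le_quotient[OF t, of x h] by linarith
qed

lemma dual_self: "dual x x = (norm x)\<^sup>2"
proof (rule antisym)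
  show "dual x x \<le> (norm x)\<^sup>2" using dual_le_norm[of x x] by (simp add: power2_eq_square)
  show "(norm x)\<^sup>2 \<le> dual x x"
  proof (rule dual_greatest)
    fix t :: real assume t: "0 < t"
    have "x + t *\<^sub>R x = (1 + t) *\<^sub>R x" by (simp add: algebra_simps)
    then have "norm (x + t *\<^sub>R x) = (1 + t) * norm x" using t by simp
    then have "dual_quotient x x t = (norm x)\<^sup>2 + t * (norm x)\<^sup>2 / 2"
      using t by (simp add: dual_quotient_def power2_eq_square field_simps)
    then show "(norm x)\<^sup>2 \<le> dual_quotient x x t" using t by simp
  qed
qed

lemma dual_subgradient: "(norm x)\<^sup>2 + 2 * dual x h \<le> (norm (x + h))\<^sup>2"
  using dual_le_quotient[of 1 x h] by (simp add: dual_quotient_def)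

text \<open>Smoothness bounds the sum of the norms of \<open>x + t *\<^sub>R h\<close> and
  \<open>x - t *\<^sub>R h\<close>, the triangle inequality their difference. The identity for
  \<open>2 * (A\<^sup>2 + B\<^sup>2)\<close> then makes the sum of the quotients at \<open>h\<close>
  and \<open>- h\<close> arbitrarily small.\<close>

lemma dual_odd:
  fixes x h :: "'a::real_normed_vector"
  assumes smooth: "modulus_uniform_smoothness TYPE('a) \<tau>"
  shows "dual x (- h) = - dual x h"
proof -
  have "dual x 0 = 0"
    using dual_scale_pos[of 2 x 0] by simp
  then have ge: "0 \<le> dual x h + dual x (- h)" using dual_subadditive[of x h "- h"] by simp
  have "dual x h + dual x (- h) \<le> 0"
  proof (cases "x = 0 \<or> h = 0")
    case True
    have "dual 0 k \<le> 0" for k :: 'a using dual_le_norm[of 0 k] by simp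
    then show ?thesis using True \<open>dual x 0 = 0\<close> by (auto intro: add_nonpos_nonpos)
  next
    case False
    define X H where "X = norm x" and "H = norm h"
    have X: "0 < X" and H: "0 < H" using False by (auto simp: X_def H_def)
    show ?thesis
    proof (rule field_le_epsilon)
      fix e :: real assume e: "0 < e"
      define s where "s = e / (2 * X * H)"
      have s: "0 < s" using e X H by (simp add: s_def)
      have tau: "0 < \<tau> s" "\<And>p q :: 'a. norm p = 1 \<Longrightarrow> norm q \<le> \<tau> s \<Longrightarrow>
          norm (p + q) + norm (p - q) \<le> 2 + s * norm q"
        using smooth s by (auto simp: modulus_uniform_smoothness_def)
      \<comment> \<open>The first bound makes smoothness applicable to
        \<open>(t / X) *\<^sub>R h\<close>; the second keeps the remainder quadratic in
        \<open>t\<close> at most \<open>2 * e * t\<close>.\<close>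
      define t where "t = min (X * \<tau> s / H) (2 * e / ((s\<^sup>2 + 4) * H\<^sup>2))"
      have pos: "0 < (s\<^sup>2 + 4) * H\<^sup>2" using H by (simp add: add_nonneg_pos)
      have t: "0 < t" using X H e tau pos by (simp add: t_def)
      have t1: "t * H \<le> X * \<tau> s"
      proof -
        have "t \<le> X * \<tau> s / H" by (simp add: t_def)
        then show ?thesis using H by (simp add: field_simps)
      qed
      have t2: "t * ((s\<^sup>2 + 4) * H\<^sup>2) \<le> 2 * e"
      proof -
        have "t \<le> 2 * e / ((s\<^sup>2 + 4) * H\<^sup>2)" by (simp add: t_def)
        then show ?thesis using pos by (simp add: pos_le_divide_eq)
      qed
      define p q where "p = x /\<^sub>R X" and "q = (t / X) *\<^sub>R h"
      have "norm p = 1" using X by (simp add: p_def X_def)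
      moreover have "norm q = t * H / X" using X t by (simp add: q_def H_def)
      ultimately have "norm (p + q) + norm (p - q) \<le> 2 + s * (t * H / X)"
        using tau(2)[of p q] t1 X by (simp add: pos_divide_le_eq mult.commute)
      then have mult: "X * (norm (p + q) + norm (p - q)) \<le> X * (2 + s * (t * H / X))"
        using X by (intro mult_left_mono) auto
      have "x + t *\<^sub>R h = X *\<^sub>R (p + q)" "x - t *\<^sub>R h = X *\<^sub>R (p - q)"
        using X by (auto simp: p_def q_def algebra_simps)
      then have "norm (x + t *\<^sub>R h) = X * norm (p + q)" "norm (x - t *\<^sub>R h) = X * norm (p - q)"
        using X by (metis abs_of_pos norm_scaleR)+
      moreover have "X * (2 + s * (t * H / X)) = 2 * X + s * t * H" using X by (simp add: field_simps)
      ultimately have sum: "norm (x + t *\<^sub>R h) + norm (x - t *\<^sub>R h) \<le> 2 * X + s * t * H"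
        using mult by (simp add: distrib_left)
      define A B where "A = norm (x + t *\<^sub>R h)" and "B = norm (x - t *\<^sub>R h)"
      have "\<bar>A - B\<bar> \<le> norm ((x + t *\<^sub>R h) - (x - t *\<^sub>R h))"
        unfolding A_def B_def by (rule norm_triangle_ineq3)
      also have "(x + t *\<^sub>R h) - (x - t *\<^sub>R h) = (2 * t) *\<^sub>R h"
        by (simp add: algebra_simps flip: scaleR_add_left)
      finally have diff: "\<bar>A - B\<bar> \<le> 2 * t * H" using t by (simp add: H_def)
      have "(A - B)\<^sup>2 \<le> (2 * t * H)\<^sup>2"
        using diff t H by (metis abs_ge_zero power2_abs power_mono)
      moreover have "(A + B)\<^sup>2 \<le> (2 * X + s * t * H)\<^sup>2"
        using sum by (intro power_mono) (auto simp: A_def B_def)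
      moreover have "2 * (A\<^sup>2 + B\<^sup>2) = (A + B)\<^sup>2 + (A - B)\<^sup>2"
        by (simp add: power2_eq_square algebra_simps)
      ultimately have "2 * (A\<^sup>2 + B\<^sup>2) \<le> (2 * X + s * t * H)\<^sup>2 + (2 * t * H)\<^sup>2" by linarith
      also have "\<dots> = 4 * X\<^sup>2 + 4 * t * (X * s * H) + t * (t * ((s\<^sup>2 + 4) * H\<^sup>2))"
        by (simp add: power2_eq_square algebra_simps)
      also have "\<dots> \<le> 4 * X\<^sup>2 + 4 * t * (X * s * H) + t * (2 * e)"
        using t2 t by simp
      also have "X * s * H = e / 2" using X H by (simp add: s_def)
      finally have "A\<^sup>2 + B\<^sup>2 - 2 * X\<^sup>2 \<le> 2 * t * e" by (simp add: algebra_simps)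
      then have "(A\<^sup>2 + B\<^sup>2 - 2 * X\<^sup>2) / (2 * t) \<le> e"
        using t by (simp add: pos_divide_le_eq mult_ac)
      moreover have "dual_quotient x h t + dual_quotient x (- h) t = (A\<^sup>2 + B\<^sup>2 - 2 * X\<^sup>2) / (2 * t)"
        by (simp add: dual_quotient_def A_def B_def X_def flip: add_divide_distrib)
      ultimately have "dual_quotient x h t + dual_quotient x (- h) t \<le> e" by simp
      then show "dual x h + dual x (- h) \<le> 0 + e"
        using dual_le_quotient[OF t, of x h] dual_le_quotient[OF t, of x "- h"] by linarith
    qed
  qed
  then show ?thesis using ge by linarith
qed

text \<open>Oddness turns subadditivity at \<open>- h\<close> and \<open>- k\<close> into
  superadditivity, and extends positive homogeneity to negative scalars.\<close>

lemma dual_linear: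
  assumes "modulus_uniform_smoothness TYPE('a::real_normed_vector) \<tau>"
  shows "linear (dual (x :: 'a))"
proof (rule linearI)
  fix h k
  have "dual x (- h + - k) \<le> dual x (- h) + dual x (- k)" by (rule dual_subadditive)
  then have "- dual x (h + k) \<le> - dual x h - dual x k"
    using dual_odd[OF assms, of x h] dual_odd[OF assms, of x k] dual_odd[OF assms, of x "h + k"]
    by simp
  then show "dual x (h + k) = dual x h + dual x k"
    using dual_subadditive[of x h k] by linarith
next
  fix c :: real and h
  show "dual x (c *\<^sub>R h) = c *\<^sub>R dual x h"
  proof (cases c "0::real" rule: linorder_cases)
    case less
    then have "dual x ((- c) *\<^sub>R h) = - c * dual x h" by (intro dual_scale_pos) simp
    then show ?thesis using dual_odd[OF assms, of x "c *\<^sub>R h"] by simp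
  next
    case equal
    then show ?thesis using dual_scale_pos[of 2 x 0] by simp
  next
    case greater
    then show ?thesis by (simp add: dual_scale_pos)
  qed
qed

lemma norm_square_add_le:
  assumes "modulus_uniform_smoothness TYPE('a::real_normed_vector) \<tau>"
  shows "(norm (x + h :: 'a))\<^sup>2 \<le> (norm x)\<^sup>2 + 2 * dual (x + h) h"
  using dual_subgradient[of "x + h" "- h"] dual_odd[OF assms, of "x + h" h] by simp

section \<open>Quantitative continuity of the duality map\<close>

lemma modulus_smoothness_upper:
  fixes p :: "'a::real_normed_vector"
  assumes smooth: "modulus_uniform_smoothness TYPE('a) \<tau>" and "norm p = 1" and "0 < r"
  shows "\<tau> r * (2 - r) \<le> 2"
proof -
  have tau: "0 < \<tau> r"
    and le: "\<And>q :: 'a. norm q \<le> \<tau> r \<Longrightarrow> norm (p + q) + norm (p - q) \<le> 2 + r * norm q"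
    using assms by (auto simp: modulus_uniform_smoothness_def)
  \<comment> \<open>Testing smoothness with a multiple of \<open>p\<close> itself yields an upper
    bound for \<open>\<tau> r\<close>.\<close>
  have "norm (p + \<tau> r *\<^sub>R p) + norm (p - \<tau> r *\<^sub>R p) \<le> 2 + r * norm (\<tau> r *\<^sub>R p)"
    using tau assms by (intro le) simp
  moreover have "p + \<tau> r *\<^sub>R p = (1 + \<tau> r) *\<^sub>R p" "p - \<tau> r *\<^sub>R p = (1 - \<tau> r) *\<^sub>R p"
    by (auto simp: algebra_simps)
  ultimately have *: "(1 + \<tau> r) + \<bar>1 - \<tau> r\<bar> \<le> 2 + r * \<tau> r"
    using tau assms by simp
  show ?thesis
  proof (cases "\<tau> r \<le> 1")
    case True
    have "\<tau> r * (2 - r) \<le> \<tau> r * 2" using tau \<open>0 < r\<close> by (intro mult_left_mono) auto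
    then show ?thesis using True by simp
  next
    case False
    then show ?thesis using * by (simp add: algebra_simps)
  qed
qed

text \<open>With \<open>k\<close> the multiple of \<open>h\<close> of norm \<open>\<tau> r\<close>,
  smoothness bounds \<open>dual p (p + k) + dual q (p - k)\<close>. Linearity isolates the
  difference at \<open>k\<close>, since \<open>dual q p\<close> is at least
  \<open>1 - norm (p - q)\<close>.\<close>

lemma dual_unit_diff:
  fixes p q h :: "'a::real_normed_vector"
  assumes smooth: "modulus_uniform_smoothness TYPE('a) \<tau>"
    and "norm p = 1" "norm q = 1" "0 < r"
  shows "dual p h - dual q h \<le> (r + norm (p - q) / \<tau> r) * norm h"
proof (cases "h = 0")
  case True
  interpret p: linear "dual p" using dual_linear[OF smooth] .
  interpret q: linear "dual q" using dual_linear[OF smooth] .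
  show ?thesis using True by (simp add: p.zero q.zero)
next
  case False
  interpret p: linear "dual p" using dual_linear[OF smooth] .
  interpret q: linear "dual q" using dual_linear[OF smooth] .
  have tau: "0 < \<tau> r"
    and le: "\<And>k :: 'a. norm k \<le> \<tau> r \<Longrightarrow> norm (p + k) + norm (p - k) \<le> 2 + r * norm k"
    using assms by (auto simp: modulus_uniform_smoothness_def)
  define c where "c = \<tau> r / norm h"
  define k where "k = c *\<^sub>R h"
  have c: "0 < c" using tau False by (simp add: c_def)
  have k: "norm k = \<tau> r" using tau False by (simp add: k_def c_def)
  have "dual p (p + k) \<le> norm (p + k)" "dual q (p - k) \<le> norm (p - k)"
    using dual_le_norm[of p "p + k"] dual_le_norm[of q "p - k"] assms by auto
  moreover have "dual p (p + k) = 1 + dual p k" using assms by (simp add: p.add dual_self)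
  moreover have "dual q (p - k) = dual q p - dual q k" by (simp add: q.diff)
  moreover have "dual q (q - p) \<le> norm (p - q)"
    using dual_le_norm[of q "q - p"] assms by (simp add: norm_minus_commute)
  then have "1 - norm (p - q) \<le> dual q p" using assms by (simp add: q.diff dual_self)
  ultimately have "dual p k - dual q k \<le> r * \<tau> r + norm (p - q)" using le[of k] k by simp
  then have "c * (dual p h - dual q h) \<le> r * \<tau> r + norm (p - q)"
    by (simp add: k_def p.scale q.scale algebra_simps)
  then have "dual p h - dual q h \<le> (r * \<tau> r + norm (p - q)) / c"
    using c by (simp add: field_simps)
  also have "\<dots> = (r + norm (p - q) / \<tau> r) * norm h"
    using tau False by (simp add: c_def field_simps)
  finally show ?thesis .
qed

lemma norm_normalize_diff:
  fixes x y :: "'a::real_normed_vector"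
  assumes "x \<noteq> 0" "y \<noteq> 0"
  shows "norm (x /\<^sub>R norm x - y /\<^sub>R norm y) \<le> 2 * norm (x - y) / norm x"
proof -
  have "norm x *\<^sub>R (x /\<^sub>R norm x - y /\<^sub>R norm y) = (x - y) + ((norm y - norm x) / norm y) *\<^sub>R y"
    using assms by (simp add: algebra_simps diff_divide_distrib divide_inverse)
  then have "norm x * norm (x /\<^sub>R norm x - y /\<^sub>R norm y)
      = norm ((x - y) + ((norm y - norm x) / norm y) *\<^sub>R y)"
    by (metis abs_norm_cancel norm_scaleR)
  also have "\<dots> \<le> norm (x - y) + norm (((norm y - norm x) / norm y) *\<^sub>R y)"
    by (rule norm_triangle_ineq)
  also have "norm (((norm y - norm x) / norm y) *\<^sub>R y) = \<bar>norm y - norm x\<bar>"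
    using assms by simp
  also have "\<bar>norm y - norm x\<bar> \<le> norm (x - y)"
    using norm_triangle_ineq3[of y x] by (simp add: norm_minus_commute)
  finally show ?thesis using assms by (simp add: field_simps)
qed

text \<open>Homogeneity in the base point reduces to unit vectors; the case split keeps both
  coefficients of the decomposition nonnegative.\<close>

lemma dual_diff_normalize:
  fixes x y h :: "'a::real_normed_vector"
  assumes smooth: "modulus_uniform_smoothness TYPE('a) \<tau>"
    and "x \<noteq> 0" "y \<noteq> 0" "0 < r"
    and d: "norm (x /\<^sub>R norm x - y /\<^sub>R norm y) / \<tau> r \<le> d"
  shows "dual x h - dual y h \<le> (min (norm x) (norm y) * (r + d) + \<bar>norm x - norm y\<bar>) * norm h"
proof -
  define p q where "p = x /\<^sub>R norm x" and "q = y /\<^sub>R norm y"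
  have pq: "norm p = 1" "norm q = 1" using assms by (auto simp: p_def q_def)
  have "dual p h - dual q h \<le> (r + norm (p - q) / \<tau> r) * norm h"
    using dual_unit_diff[OF smooth pq \<open>0 < r\<close>] .
  also have "\<dots> \<le> (r + d) * norm h"
    using d by (intro mult_right_mono) (auto simp: p_def q_def)
  finally have unit: "dual p h - dual q h \<le> (r + d) * norm h" .
  have "x = norm x *\<^sub>R p" "y = norm y *\<^sub>R q" using assms by (auto simp: p_def q_def)
  then have x: "dual x h = norm x * dual p h" and y: "dual y h = norm y * dual q h"
    using dual_scale_left assms by (metis zero_less_norm_iff)+
  show ?thesis
  proof (cases "norm x \<le> norm y")
    case True
    have "dual x h - dual y h = norm x * (dual p h - dual q h) + (norm y - norm x) * dual q (- h)"
      by (simp add: x y dual_odd[OF smooth] algebra_simps)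
    also have "\<dots> \<le> norm x * ((r + d) * norm h) + (norm y - norm x) * norm h"
      using unit True dual_le_norm[of q "- h"] pq by (intro add_mono mult_left_mono) auto
    finally show ?thesis using True by (simp add: algebra_simps)
  next
    case False
    have "dual x h - dual y h = norm y * (dual p h - dual q h) + (norm x - norm y) * dual p h"
      by (simp add: x y algebra_simps)
    also have "\<dots> \<le> norm y * ((r + d) * norm h) + (norm x - norm y) * norm h"
      using unit False dual_le_norm[of p h] pq by (intro add_mono mult_left_mono) auto
    finally show ?thesis using False by (simp add: algebra_simps)
  qed
qed

context metastability_rate
begin

lemma omega_eq:
  assumes "b \<ge> 1"
  shows "omega s = min s 2 * (min s 2 / (2 * real b) * \<tau> (min s 2 / (2 * real b))) / 6"
  using assms by (simp add: omega_def power2_eq_square max_def)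

lemma omega_pos:
  assumes "modulus_uniform_smoothness TYPE('a::real_normed_vector) \<tau>" "b \<ge> 1" "0 < s"
  shows "0 < omega s"
proof -
  have "0 < min s 2 / (2 * real b)" using assms by simp
  then have "0 < \<tau> (min s 2 / (2 * real b))"
    using assms by (auto simp: modulus_uniform_smoothness_def)
  then show ?thesis using assms by (simp add: omega_eq)
qed

lemma omega_le:
  fixes p :: "'a::real_normed_vector"
  assumes "modulus_uniform_smoothness TYPE('a) \<tau>" "b \<ge> 1" "0 < s" "norm p = 1"
  shows "omega s \<le> min s 2 / 3"
proof -
  define r where "r = min s 2 / (2 * real b)"
  have r: "0 < r" "r \<le> 1" using assms by (auto simp: r_def min_def field_simps)
  have tau: "0 < \<tau> r" using assms r by (auto simp: modulus_uniform_smoothness_def)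
  have "\<tau> r * (2 - r) \<le> 2" using modulus_smoothness_upper assms r by blast
  moreover have "\<tau> r * 1 \<le> \<tau> r * (2 - r)" using tau r by (intro mult_left_mono) auto
  ultimately have "\<tau> r \<le> 2" by simp
  then have "r * \<tau> r \<le> 1 * 2" using r tau by (intro mult_mono) auto
  then have "min s 2 * (r * \<tau> r) / 6 \<le> min s 2 * 2 / 6"
    using assms by (intro divide_right_mono mult_left_mono) auto
  then show ?thesis using assms by (simp add: omega_eq r_def)
qed

text \<open>Away from the origin the normalized vectors are close and
  \<open>dual_diff_normalize\<close> applies; near the origin both values of \<open>dual\<close> are
  small by themselves. Hence the split at \<open>s'\<close>.\<close>

lemma dual_diff_le:
  fixes x y h :: "'a::real_normed_vector"
  assumes smooth: "modulus_uniform_smoothness TYPE('a) \<tau>" and b: "b \<ge> 1" and "0 < s"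
    and "norm x \<le> b" "norm y \<le> b" and close: "norm (x - y) \<le> omega s"
  shows "dual x h - dual y h \<le> s * norm h"
proof -
  define s' where "s' = min s 2"
  define r where "r = s' / (2 * real b)"
  have s': "0 < s'" "s' \<le> s" "s' \<le> 2" using assms by (auto simp: s'_def)
  have r: "0 < r" "r \<le> 1" using b s' by (auto simp: r_def field_simps)
  have tau: "0 < \<tau> r" using smooth r by (auto simp: modulus_uniform_smoothness_def)
  have omega: "omega s = s' * (r * \<tau> r) / 6" by (simp add: omega_eq[OF b] s'_def r_def)
  have "dual x h - dual y h \<le> s' * norm h"
  proof (cases "norm x + norm y \<le> s'")
    case True
    have "dual x h - dual y h = dual x h + dual y (- h)" by (simp add: dual_odd[OF smooth])
    also have "\<dots> \<le> (norm x + norm y) * norm h"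
      using dual_le_norm[of x h] dual_le_norm[of y "- h"] by (simp add: algebra_simps)
    also have "\<dots> \<le> s' * norm h" using True by (intro mult_right_mono) auto
    finally show ?thesis .
  next
    case False
    then have "\<exists>p :: 'a. norm p = 1"
      using s' by (metis add_0 norm_le_zero_iff norm_sgn norm_zero order_less_imp_le)
    then obtain p :: 'a where p: "norm p = 1" by blast
    have third: "omega s \<le> s' / 3" using omega_le[OF smooth b \<open>0 < s\<close> p] by (simp add: s'_def)
    have r_tau: "\<tau> r * (2 - r) \<le> 2" using modulus_smoothness_upper[OF smooth p] r by blast
    have nz: "x \<noteq> 0" "y \<noteq> 0"
      using False close third s' by auto
    define q where "q = norm (x /\<^sub>R norm x - y /\<^sub>R norm y)"
    have q1: "q \<le> 2 * norm (x - y) / norm x" unfolding q_def by (rule norm_normalize_diff[OF nz])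
    have q2: "q \<le> 2 * norm (x - y) / norm y"
      using norm_normalize_diff[OF nz(2,1)] by (simp add: q_def norm_minus_commute)
    have half: "q \<le> 4 * omega s / s'"
    proof -
      \<comment> \<open>One of the two norms exceeds \<open>s' / 2\<close>, and either may serve as
        divisor in the bound for \<open>q\<close>.\<close>
      have *: "2 * norm (x - y) / n \<le> 4 * omega s / s'" if "s' / 2 < n" for n
      proof -
        have "2 * norm (x - y) / n \<le> 2 * omega s / (s' / 2)"
          using that close s' order_trans[OF norm_ge_zero close] by (intro frac_le) auto
        then show ?thesis by simp
      qed
      show ?thesis
        using False *[of "norm x"] *[of "norm y"] q1 q2 by linarith
    qed
    have "4 * omega s / s' = (2 * r / 3) * \<tau> r" using s' by (simp add: omega)
    then have d: "q / \<tau> r \<le> 2 * r / 3" using half tau by (simp add: pos_divide_le_eq)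
    define m e where "m = min (norm x) (norm y)" and "e = \<bar>norm x - norm y\<bar>"
    have me: "m \<le> b - e" "0 \<le> e" using assms by (auto simp: m_def e_def)
    have e: "e \<le> omega s" using norm_triangle_ineq3[of x y] close by (simp add: e_def)
    have "dual x h - dual y h \<le> (m * (r + 2 * r / 3) + e) * norm h"
      unfolding m_def e_def using dual_diff_normalize[OF smooth nz r(1) d[unfolded q_def]] .
    also have "\<dots> \<le> s' * norm h"
    proof (intro mult_right_mono)
      have "m * (r + 2 * r / 3) \<le> (b - e) * (r + 2 * r / 3)"
        using me r by (intro mult_right_mono) auto
      then have 1: "m * (r + 2 * r / 3) + e \<le> 5 * s' / 6 + e * (1 - 5 * r / 3)"
      proof -
        have "(b - e) * (r + 2 * r / 3) = 5 / 3 * (b * r) - e * (5 * r / 3)"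
          by (simp add: field_simps)
        also have "b * r = s' / 2" using b by (simp add: r_def)
        finally have "(b - e) * (r + 2 * r / 3) = 5 * s' / 6 - e * (5 * r / 3)" by simp
        moreover have "e * (1 - 5 * r / 3) = e - e * (5 * r / 3)" by (simp add: algebra_simps)
        ultimately show ?thesis using \<open>m * (r + 2 * r / 3) \<le> (b - e) * (r + 2 * r / 3)\<close>
          by linarith
      qed
      \<comment> \<open>What exceeds \<open>5 * s' / 6\<close> has to fit into
        \<open>s' / 6\<close>: either the coefficient of \<open>e\<close> is nonpositive, or
        \<open>r < 3 / 5\<close> and then \<open>r * \<tau> r \<le> 1\<close>, so that
        \<open>omega s\<close> is at most \<open>s' / 6\<close>.\<close>
      have "e * (1 - 5 * r / 3) \<le> s' / 6"
      proof (cases "1 \<le> 5 * r / 3")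
        case True
        then have "e * (1 - 5 * r / 3) \<le> 0" using me by (intro mult_nonneg_nonpos) auto
        then show ?thesis using s' by simp
      next
        case False
        then have "2 * r \<le> 2 - r" by simp
        then have "2 * r * \<tau> r \<le> (2 - r) * \<tau> r" using tau by (intro mult_right_mono) auto
        moreover have "(2 - r) * \<tau> r \<le> 2" using r_tau by (simp only: mult.commute)
        ultimately have "r * \<tau> r \<le> 1" by linarith
        then have "s' * (r * \<tau> r) / 6 \<le> s' * 1 / 6"
          using s' by (intro divide_right_mono mult_left_mono) auto
        then have "e \<le> s' / 6" using e omega by simp
        moreover have "e * (1 - 5 * r / 3) \<le> e * 1" using me r by (intro mult_left_mono) auto
        ultimately show ?thesis by simp
      qed
      then show "m * (r + 2 * r / 3) + e \<le> s'" using 1 by simp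
    qed simp
    finally show ?thesis .
  qed
  also have "\<dots> \<le> s * norm h" using s' by (intro mult_right_mono) auto
  finally show ?thesis .
qed

section \<open>Uniform convexity of the squared norm\<close>

lemma psi_pos:
  assumes "modulus_uniform_convexity TYPE('a::real_normed_vector) \<eta>" "b \<ge> 1" "0 < (s :: real)" "s \<le> 4 * b"
  shows "0 < psi s"
proof -
  have "s / (2 * real b) \<in> {0<..2}" using assms by (simp add: field_simps)
  then have "0 < \<eta> (s / (2 * real b))"
    using assms by (auto simp: modulus_uniform_convexity_def)
  then show ?thesis using assms by (simp add: psi_def min_def)
qed

lemma psi_le:
  assumes "modulus_uniform_convexity TYPE('a::real_normed_vector) \<eta>" "b \<ge> 1" "0 < (s :: real)" "s \<le> 4 * b"
  shows "psi s \<le> s\<^sup>2 / 48"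
proof -
  have "s / (2 * real b) \<in> {0<..2}" using assms by (simp add: field_simps)
  then have "0 < \<eta> (s / (2 * real b))" "\<eta> (s / (2 * real b)) \<le> 1"
    using assms by (auto simp: modulus_uniform_convexity_def)
  then have "(\<eta> (s / (2 * real b)))\<^sup>2 \<le> 1" by (simp add: power_le_one)
  then have "s\<^sup>2 / 48 * (\<eta> (s / (2 * real b)))\<^sup>2 \<le> s\<^sup>2 / 48 * 1" by (intro mult_left_mono) auto
  then show ?thesis by (simp add: psi_def)
qed

text \<open>If the norms differ by at least \<open>d\<close>, squaring their mean already gains
  \<open>d\<^sup>2 / 4\<close>. Otherwise both vectors are divided by the larger norm; uniform
  convexity gains at separation \<open>r\<close>, and the small difference of the norms costs
  little.\<close>

lemma midpoint_psi_aux: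
  fixes x y :: "'a::real_normed_vector"
  assumes convex: "modulus_uniform_convexity TYPE('a) \<eta>" and b: "b \<ge> 1" and "0 < s"
    and "norm x \<le> b" and xy: "norm y \<le> norm x" and sep: "s \<le> norm (x - y)"
  shows "(norm ((x + y) /\<^sub>R 2))\<^sup>2 + psi s \<le> (norm x)\<^sup>2 / 2 + (norm y)\<^sup>2 / 2"
proof -
  define r where "r = s / (2 * real b)"
  define X Y where "X = norm x" and "Y = norm y"
  have "norm (x - y) \<le> X + Y" unfolding X_def Y_def by (rule norm_triangle_ineq4)
  then have sX: "s \<le> 2 * X" using sep xy by (simp add: X_def Y_def)
  then have X: "0 < X" "X \<le> b" "Y \<le> X" "0 \<le> Y" using assms by (auto simp: X_def Y_def)
  have r: "r \<in> {0<..2}" using sX X \<open>0 < s\<close> b by (simp add: r_def field_simps)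
  then have eta: "0 < \<eta> r" "\<eta> r \<le> 1"
    and mid: "\<And>p q :: 'a. norm p \<le> 1 \<Longrightarrow> norm q \<le> 1 \<Longrightarrow> r \<le> norm (p - q) \<Longrightarrow>
        norm ((p + q) /\<^sub>R 2) \<le> 1 - \<eta> r"
    using convex by (auto simp: modulus_uniform_convexity_def)
  define d where "d = min (s / 2) (s\<^sup>2 / (72 * real b) * (\<eta> r)\<^sup>2)"
  have psi: "psi s = min (d\<^sup>2 / 4) (s\<^sup>2 / 48 * (\<eta> r)\<^sup>2)" by (simp add: psi_def d_def r_def)
  have d: "0 < d" using b \<open>0 < s\<close> eta by (simp add: d_def)
  show ?thesis
  proof (cases "d \<le> X - Y")
    case True
    have "norm ((x + y) /\<^sub>R 2) \<le> (X + Y) / 2"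
      using norm_triangle_ineq[of x y] by (simp add: X_def Y_def)
    then have "(norm ((x + y) /\<^sub>R 2))\<^sup>2 \<le> ((X + Y) / 2)\<^sup>2" by (intro power_mono) auto
    moreover have "d\<^sup>2 \<le> (X - Y)\<^sup>2" using True d by (intro power_mono) auto
    moreover have "((X + Y) / 2)\<^sup>2 + (X - Y)\<^sup>2 / 4 = X\<^sup>2 / 2 + Y\<^sup>2 / 2"
      by (simp add: power2_eq_square field_simps)
    moreover have "psi s \<le> d\<^sup>2 / 4" using psi by simp
    ultimately show ?thesis unfolding X_def Y_def by linarith
  next
    case False
    define E where "E = (\<eta> r)\<^sup>2"
    have E: "0 < E" "E \<le> \<eta> r" using eta by (auto simp: E_def power2_eq_square mult_left_le)
    have "r * X \<le> s"
    proof -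
      have "s * X \<le> s * (2 * b)" using X \<open>0 < s\<close> by (intro mult_left_mono) auto
      then show ?thesis using b by (simp add: r_def field_simps)
    qed
    then have "r \<le> norm (x - y) / X" using sep X by (simp add: pos_le_divide_eq)
    also have "\<dots> = norm (x /\<^sub>R X - y /\<^sub>R X)"
      using X by (simp add: divide_inverse flip: scaleR_diff_right)
    finally have *: "norm ((x /\<^sub>R X + y /\<^sub>R X) /\<^sub>R 2) \<le> 1 - \<eta> r"
      using X by (intro mid) (auto simp: X_def Y_def field_simps)
    have "(x /\<^sub>R X + y /\<^sub>R X) /\<^sub>R 2 = ((x + y) /\<^sub>R 2) /\<^sub>R X" by (simp add: scaleR_add_right)
    moreover have "norm (((x + y) /\<^sub>R 2) /\<^sub>R X) = norm ((x + y) /\<^sub>R 2) / X"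
      unfolding norm_scaleR[of "inverse X"] using X by (simp only: divide_inverse) simp
    ultimately have "norm ((x /\<^sub>R X + y /\<^sub>R X) /\<^sub>R 2) = norm ((x + y) /\<^sub>R 2) / X"
      by (simp only:)
    then have "norm ((x + y) /\<^sub>R 2) \<le> X * (1 - \<eta> r)"
      using X * by (simp add: pos_divide_le_eq mult_ac)
    then have "(norm ((x + y) /\<^sub>R 2))\<^sup>2 \<le> (X * (1 - \<eta> r))\<^sup>2" by (intro power_mono) auto
    also have "\<dots> = X\<^sup>2 - X\<^sup>2 * (\<eta> r + (\<eta> r - E))" by (simp add: E_def power2_eq_square algebra_simps)
    also have "\<dots> \<le> X\<^sup>2 - X\<^sup>2 * E" using E by (simp add: mult_left_mono)
    finally have 1: "(norm ((x + y) /\<^sub>R 2))\<^sup>2 \<le> X\<^sup>2 - X\<^sup>2 * E" .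
    have "s / 2 * (s / 2) \<le> X * X" using sX \<open>0 < s\<close> by (intro mult_mono) auto
    then have "s\<^sup>2 / 4 \<le> X\<^sup>2" by (simp add: power2_eq_square)
    then have 2: "s\<^sup>2 / 4 * E \<le> X\<^sup>2 * E" using E by (intro mult_right_mono) auto
    \<comment> \<open>By the choice of \<open>d\<close>, treating \<open>Y\<close> as
      \<open>X\<close> costs at most \<open>s\<^sup>2 * E / 72\<close>, which leaves at least
      \<open>s\<^sup>2 * E / 48\<close> of the gain \<open>s\<^sup>2 * E / 4\<close>.\<close>
    have "X * d \<le> b * (s\<^sup>2 / (72 * real b) * E)"
      using X d by (intro mult_mono) (auto simp: d_def E_def)
    then have 3: "X * d \<le> s\<^sup>2 * E / 72" using b by simp
    have "0 \<le> X - d" using sX by (simp add: d_def min_def)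
    then have "(X - d)\<^sup>2 \<le> Y\<^sup>2" using False by (intro power_mono) auto
    moreover have "(X - d)\<^sup>2 = X\<^sup>2 - 2 * (X * d) + d\<^sup>2" by (simp add: power2_eq_square algebra_simps)
    ultimately have 4: "X\<^sup>2 - 2 * (X * d) \<le> Y\<^sup>2" using zero_le_power2[of d] by linarith
    have 5: "psi s \<le> s\<^sup>2 * E / 48" using psi by (simp add: E_def)
    have 6: "0 \<le> s\<^sup>2 * E" using E by simp
    have "s\<^sup>2 / 4 * E = s\<^sup>2 * E / 4" by simp
    then show ?thesis using 1 2 3 4 5 6 unfolding X_def[symmetric] Y_def[symmetric] by linarith
  qed
qed

lemma midpoint_psi:
  fixes x y :: "'a::real_normed_vector"
  assumes "modulus_uniform_convexity TYPE('a) \<eta>" "b \<ge> 1" "0 < s"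
    and "norm x \<le> b" "norm y \<le> b" "s \<le> norm (x - y)"
  shows "(norm ((x + y) /\<^sub>R 2))\<^sup>2 + psi s \<le> (norm x)\<^sup>2 / 2 + (norm y)\<^sup>2 / 2"
  using midpoint_psi_aux[of s x y] midpoint_psi_aux[of s y x] assms
  by (cases "norm y \<le> norm x") (auto simp: norm_minus_commute add.commute)

end

subsection \<open>Chebyshev radii of finite segments\<close>

definition cheb_dist :: "(nat \<Rightarrow> 'a::real_normed_vector) \<Rightarrow> nat set \<Rightarrow> 'a \<Rightarrow> real" where
  "cheb_dist Z S y = Max ((\<lambda>n. (norm (Z n - y))\<^sup>2) ` S)"

text \<open>The squared Chebyshev radius relative to \<open>C\<close>, in the form that suits
  \<open>midpoint_psi\<close>. It is only approached, through \<open>cheb_radius_near\<close>, and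
  never assumed to be attained.\<close>

definition cheb_radius :: "'a::real_normed_vector set \<Rightarrow> (nat \<Rightarrow> 'a) \<Rightarrow> nat set \<Rightarrow> real" where
  "cheb_radius C Z S = (INF y\<in>C. cheb_dist Z S y)"

lemma cheb_dist_ge:
  assumes "finite S" "n \<in> S"
  shows "(norm (Z n - y))\<^sup>2 \<le> cheb_dist Z S y"
  unfolding cheb_dist_def using assms by (intro Max_ge) auto

lemma cheb_dist_attained:
  assumes "finite S" "S \<noteq> {}"
  obtains n where "n \<in> S" "cheb_dist Z S y = (norm (Z n - y))\<^sup>2"
proof -
  have "cheb_dist Z S y \<in> (\<lambda>n. (norm (Z n - y))\<^sup>2) ` S"
    unfolding cheb_dist_def using assms by (intro Max_in) auto
  then show ?thesis using that by auto
qed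

lemma cheb_dist_nonneg:
  assumes "finite S" "S \<noteq> {}"
  shows "0 \<le> cheb_dist Z S y"
  using cheb_dist_attained[OF assms, of Z y] by (metis zero_le_power2)

lemma cheb_dist_bdd:
  assumes "finite S" "S \<noteq> {}"
  shows "bdd_below (cheb_dist Z S ` C)"
  using cheb_dist_nonneg[OF assms] by (auto intro!: bdd_belowI)

lemma cheb_radius_le:
  assumes "finite S" "S \<noteq> {}" "y \<in> C"
  obtains n where "n \<in> S" "cheb_radius C Z S \<le> (norm (Z n - y))\<^sup>2"
proof -
  obtain n where "n \<in> S" "cheb_dist Z S y = (norm (Z n - y))\<^sup>2"
    using cheb_dist_attained[OF assms(1,2)] .
  moreover have "cheb_radius C Z S \<le> cheb_dist Z S y"
    unfolding cheb_radius_def using assms by (intro cINF_lower cheb_dist_bdd)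
  ultimately show ?thesis using that by simp
qed

lemma cheb_radius_near:
  assumes "finite S" "C \<noteq> {}" "0 < e"
  obtains y where "y \<in> C" "\<And>n. n \<in> S \<Longrightarrow> (norm (Z n - y))\<^sup>2 < cheb_radius C Z S + e"
proof -
  have "Inf (cheb_dist Z S ` C) < cheb_radius C Z S + e"
    using assms by (simp add: cheb_radius_def)
  then obtain y where "y \<in> C" "cheb_dist Z S y < cheb_radius C Z S + e"
    using cInf_lessD[of "cheb_dist Z S ` C"] assms by auto
  then show ?thesis using that cheb_dist_ge[OF assms(1)] by (meson le_less_trans)
qed

lemma cheb_radius_nonneg:
  assumes "finite S" "S \<noteq> {}" "C \<noteq> {}"
  shows "0 \<le> cheb_radius C Z S"
  unfolding cheb_radius_def using assms cheb_dist_nonneg by (intro cINF_greatest) auto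

lemma cheb_radius_upper:
  assumes "finite S" "S \<noteq> {}" "y \<in> C" "\<And>n. n \<in> S \<Longrightarrow> norm (Z n - y) \<le> b"
  shows "cheb_radius C Z S \<le> b\<^sup>2"
proof -
  obtain n where "n \<in> S" "cheb_radius C Z S \<le> (norm (Z n - y))\<^sup>2"
    using cheb_radius_le[OF assms(1-3)] .
  moreover have "(norm (Z n - y))\<^sup>2 \<le> b\<^sup>2" using assms \<open>n \<in> S\<close> by (intro power_mono) auto
  ultimately show ?thesis by simp
qed

text \<open>Each failure of stability passes to a segment one level lower on which \<open>V\<close> has dropped by \<open>d\<close>.\<close>

lemma stable_segment:
  fixes V :: "nat set \<Rightarrow> real" and d :: real and D L :: nat and u :: "nat \<Rightarrow> nat \<Rightarrow> nat" and \<kappa> :: "nat \<Rightarrow> nat \<Rightarrow> nat"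
  assumes nonneg: "\<And>m n. m \<le> n \<Longrightarrow> 0 \<le> V {m..n}"
    and step: "\<And>i m. u i m \<le> u (Suc i) m"
    and tail: "\<And>i m. \<kappa> i m + u i (m + \<kappa> i m) \<le> u (Suc i) m"
    and "D \<le> L" "V {m..m + u L m} < D * d"
  shows "\<exists>i n. L \<le> D + i \<and> m \<le> n \<and> n + u (Suc i) n \<le> m + u L m \<and>
    V {n..n + u (Suc i) n} \<le> V {n..n + u i n} + d \<and>
    V {n..n + u (Suc i) n} \<le> V {n + \<kappa> i n..n + \<kappa> i n + u i (n + \<kappa> i n)} + d"
  using assms(4,5)
proof (induction D arbitrary: L m)
  case 0
  then show ?case using nonneg[of m "m + u L m"] by simp
next
  case (Suc D)
  then obtain i where L: "L = Suc i" "D \<le> i" by (cases L) auto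
  let ?B = "{m..m + u (Suc i) m}"
  have V: "V ?B < D * d + d" using Suc.prems L by (simp add: algebra_simps)
  \<comment> \<open>Either \<open>i\<close> and \<open>m\<close> already work, or the subsegment
    starting at \<open>n = m\<close> or at \<open>n = m + \<kappa> i m\<close> has lost more than
    \<open>d\<close>, which leaves the budget \<open>D * d\<close>.\<close>
  consider "V ?B \<le> V {m..m + u i m} + d"
      "V ?B \<le> V {m + \<kappa> i m..m + \<kappa> i m + u i (m + \<kappa> i m)} + d"
    | n where "m \<le> n" "n + u i n \<le> m + u L m" "V {n..n + u i n} + d < V ?B"
    using step[of i m] tail[of i m] L by (metis add_le_mono1 le_add1 le_refl nat_add_left_cancel_le not_le group_cancel.add1)
  then show ?case
  proof cases
    case 1
    then show ?thesis using L by (intro exI[of _ i] exI[of _ m]) auto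
  next
    case (2 n)
    then have "V {n..n + u i n} < D * d" using V by simp
    then obtain i' n' where *: "i \<le> D + i'" "n \<le> n'" "n' + u (Suc i') n' \<le> n + u i n"
        "V {n'..n' + u (Suc i') n'} \<le> V {n'..n' + u i' n'} + d"
        "V {n'..n' + u (Suc i') n'} \<le> V {n' + \<kappa> i' n'..n' + \<kappa> i' n' + u i' (n' + \<kappa> i' n')} + d"
      using Suc.IH[OF \<open>D \<le> i\<close>] by blast
    then have "n' + u (Suc i') n' \<le> m + u L m" using 2 by linarith
    then show ?thesis using * 2 L by (intro exI[of _ i'] exI[of _ n']) auto
  qed
qed

text \<open>In the end \<open>\<epsilon>\<close> will be half of the desired accuracy. The unit
  vector from \<open>nontrivial\<close> gives access to the upper bound
  \<open>omega_le\<close>.\<close>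

locale pseudocontraction_approximants = metastability_rate b \<eta> \<tau> \<theta> \<alpha> \<gamma> \<epsilon> g
  for b :: nat and \<eta> \<tau> \<theta> :: "real \<Rightarrow> real" and \<alpha> \<gamma> :: "nat \<Rightarrow> nat" and \<epsilon> :: real
    and g :: "nat \<Rightarrow> nat" +
  fixes C :: "'a::real_normed_vector set" and T :: "'a \<Rightarrow> 'a" and x :: 'a
    and X :: "nat \<Rightarrow> 'a" and t :: "nat \<Rightarrow> real"
  assumes convexity: "modulus_uniform_convexity TYPE('a) \<eta>"
    and smooth: "modulus_uniform_smoothness TYPE('a) \<tau>"
    and convex_C: "convex C"
    and b: "b \<ge> 1"
    and diff_le: "\<And>y z. y \<in> C \<Longrightarrow> z \<in> C \<Longrightarrow> norm (y - z) \<le> b"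
    and pseudo: "pseudocontraction_on C T"
    and cont: "modulus_uniform_continuity_on C T \<theta>"
    and x: "x \<in> C"
    and X: "\<And>n. X n \<in> C" "\<And>n. X n = t n *\<^sub>R T (X n) + (1 - t n) *\<^sub>R x"
    and t: "\<And>n. 0 < t n" "\<And>n. t n < 1"
    and gamma: "\<And>n. \<gamma> n \<ge> 1"
    and alpha: "\<And>n m. m \<ge> \<alpha> n \<Longrightarrow> t m \<ge> 1 - 1 / (real n + 1)"
    and t_gamma: "\<And>n. t n \<le> 1 - 1 / real (\<gamma> n)"
    and eps: "0 < \<epsilon>"
    and nontrivial: "\<exists>p :: 'a. norm p = 1"
begin

lemma dual_lin: "linear (dual (y :: 'a))"
  by (rule dual_linear[OF smooth])

lemmas dual_add = linear_add[OF dual_lin]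
  and dual_diff = linear_diff[OF dual_lin]
  and dual_scale = linear_scale[OF dual_lin]

lemma T_in: "y \<in> C \<Longrightarrow> T y \<in> C"
  using pseudo by (auto simp: pseudocontraction_on_def)

lemma dual_bound:
  assumes "y \<in> C" "z \<in> C"
  shows "dual (y - z) h \<le> b * norm h"
proof -
  have "dual (y - z) h \<le> norm (y - z) * norm h" by (rule dual_le_norm)
  also have "\<dots> \<le> b * norm h" using diff_le[OF assms] by (intro mult_right_mono) auto
  finally show ?thesis .
qed

lemma dual_close:
  assumes "0 < s" "y \<in> C" "z \<in> C" "y' \<in> C" "z' \<in> C" "norm ((y - z) - (y' - z')) \<le> omega s"
  shows "dual (y - z) h \<le> dual (y' - z') h + s * norm h"
  using dual_diff_le[OF smooth b assms(1) _ _ assms(6), of h] diff_le assms by simp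

text \<open>Pseudocontractivity with factor \<open>1 / l\<close>, multiplied by \<open>l\<close>,
  says that the norm does not decrease in this direction, so every quotient is nonnegative.\<close>

lemma accretive:
  assumes "y \<in> C" "z \<in> C"
  shows "0 \<le> dual (y - z) ((y - T y) - (z - T z))"
proof (rule dual_greatest)
  fix l :: real assume l: "0 < l"
  let ?d = "(y - T y) - (z - T z)"
  have "(1 / l) * norm (y - z) \<le> norm ((1 / l + 1) *\<^sub>R (y - z) - (T y - T z))"
  proof -
    have "\<forall>t>0. t * norm (y - z) \<le> norm ((t + 1) *\<^sub>R (y - z) - (T y - T z))"
      using pseudo assms by (auto simp: pseudocontraction_on_def)
    then show ?thesis using l by (metis zero_less_divide_1_iff)
  qed
  then have "l * ((1 / l) * norm (y - z)) \<le> l * norm ((1 / l + 1) *\<^sub>R (y - z) - (T y - T z))"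
    using l by (intro mult_left_mono) auto
  also have "\<dots> = norm (l *\<^sub>R ((1 / l + 1) *\<^sub>R (y - z) - (T y - T z)))" using l by simp
  also have "l *\<^sub>R ((1 / l + 1) *\<^sub>R (y - z) - (T y - T z)) = (y - z) + l *\<^sub>R ?d"
  proof -
    have "l *\<^sub>R ((1 / l + 1) *\<^sub>R (y - z)) = (y - z) + l *\<^sub>R (y - z)"
      using l by (simp add: scaleR_add_left scaleR_add_right)
    then show ?thesis by (simp add: scaleR_diff_right)
  qed
  finally have "norm (y - z) \<le> norm ((y - z) + l *\<^sub>R ?d)" using l by simp
  then have "(norm (y - z))\<^sup>2 \<le> (norm ((y - z) + l *\<^sub>R ?d))\<^sup>2" by (intro power_mono) auto
  then show "0 \<le> dual_quotient (y - z) ?d l" using l by (simp add: dual_quotient_def)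
qed

subsection \<open>Positivity of the parameters\<close>

lemma omega_pos': "0 < s \<Longrightarrow> 0 < omega s"
  using omega_pos[OF smooth b] .

lemma omega_le': "0 < s \<Longrightarrow> omega s \<le> 2 / 3"
  using omega_le[OF smooth b] nontrivial by force

lemma nu4_pos: "0 < nu4"
  using eps b omega_pos'[of "\<epsilon>\<^sup>2 / (96 * real b)"] by (simp add: nu4_def)

lemma nu4_bounds:
  "nu4 \<le> \<epsilon> ^ 4 / (9216 * (real b)\<^sup>2)" "nu4 \<le> (omega (\<epsilon>\<^sup>2 / (96 * real b)))\<^sup>2" "nu4 \<le> \<epsilon>\<^sup>2 / 16"
  by (auto simp: nu4_def)

lemma p0_pos: "0 < p0"
  using nu4_pos eps by (simp add: p0_def)

lemma p0_le: "p0 \<le> 1"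
proof -
  have "0 < \<epsilon>\<^sup>2 / (96 * real b)" using eps b by simp
  then have "(omega (\<epsilon>\<^sup>2 / (96 * real b)))\<^sup>2 \<le> (2 / 3)\<^sup>2"
    using omega_le' omega_pos' by (intro power_mono) (auto intro: less_imp_le)
  also have "\<dots> \<le> (3 :: real)" by (simp add: power2_eq_square)
  finally show ?thesis using nu4_bounds(2) by (simp add: p0_def)
qed

lemma delta_pos: "0 < delta"
  using nu4_pos b omega_pos'[of "nu4 / (3 * real b)"] by (simp add: delta_def)

lemma psi_pos':
  assumes "0 < s" "s \<le> 4"
  shows "0 < psi s"
  using assms b by (intro psi_pos[OF convexity b]) auto

lemma nu2_pos: "0 < nu2"
proof -
  have "0 < p0 / (2 * real b)" using p0_pos b by simp
  then show ?thesis
    using omega_pos' omega_le'[of "p0 / (2 * real b)"] by (simp add: nu2_def psi_pos')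
qed

lemma u0_pos: "0 < u0"
  using nu4_pos delta_pos nu2_pos by (simp add: u0_def)

lemma beta_pos: "0 < beta c"
  using p0_pos b gamma[of c] by (simp add: beta_def)

lemma beta_gamma: "beta c * real (\<gamma> c) = p0 / (2 * real b)"
  using gamma[of c] by (simp add: beta_def)

lemma beta_le: "beta c \<le> 1 / real (\<gamma> c)"
proof -
  have "beta c * real (\<gamma> c) \<le> 1 / 2" using p0_le p0_pos b by (simp add: beta_gamma divide_le_eq)
  then show ?thesis using gamma[of c] by (simp add: pos_le_divide_eq)
qed

lemma theta_tilde_bounds: "0 < theta_tilde (beta c)" "theta_tilde (beta c) \<le> beta c / 4"
  "theta_tilde (beta c) \<le> \<theta> (beta c / 2)"
  using cont beta_pos[of c] by (auto simp: theta_tilde_def modulus_uniform_continuity_on_def)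

lemma theta_tilde_le: "theta_tilde (beta c) \<le> 1 / (4 * real (\<gamma> c))"
  using theta_tilde_bounds(2)[of c] beta_le[of c] by simp

lemma psi_theta_pos: "0 < psi (theta_tilde (beta c))"
proof -
  have "1 / (4 * real (\<gamma> c)) \<le> 1 / 4" using gamma[of c] by (simp add: field_simps)
  then show ?thesis
    using theta_tilde_le[of c] theta_tilde_bounds(1)[of c] by (intro psi_pos') auto
qed

lemma nu1_star_pos: "0 < nu1_star m n"
  using psi_theta_pos by (simp add: nu1_star_def)

lemma nu1_star_le:
  assumes "c \<le> max m (n + running_max g n)"
  shows "2 * nu1_star m n \<le> psi (theta_tilde (beta c))"
proof -
  have "Min ((\<lambda>c. psi (theta_tilde (beta c))) ` {..max m (n + running_max g n)})
      \<le> psi (theta_tilde (beta c))"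
    using assms by (intro Min_le) auto
  then show ?thesis by (simp add: nu1_star_def)
qed

section \<open>The index beyond which residuals are small\<close>

lemma running_max_ge: "i \<le> n \<Longrightarrow> f i \<le> running_max f n"
  unfolding running_max_def by (intro Max_ge) auto

lemma running_max_mono: "m \<le> n \<Longrightarrow> running_max f m \<le> running_max f n"
  unfolding running_max_def by (intro Max_mono) auto

lemma nu1_star_antimono:
  assumes "m \<le> m'" "n \<le> n'"
  shows "nu1_star m' n' \<le> nu1_star m n"
proof -
  have "max m (n + running_max g n) \<le> max m' (n' + running_max g n')"
    using assms running_max_mono[OF assms(2), of g] by (intro max.mono add_mono) auto
  then show ?thesis
    unfolding nu1_star_def by (intro mult_left_mono Min_antimono image_mono) auto
qed

text \<open>This is \<open>iota\<close> as a function of the two values of \<open>k_tilde\<close>,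
  see \<open>iota_eq\<close>; in this form it is monotone.\<close>

definition threshold :: "nat \<Rightarrow> nat \<Rightarrow> nat" where
  "threshold m n = running_max \<alpha>
     (nat \<lceil>max (2 * real b / sqrt (nu1_star m n)) (8 * (real b)\<^sup>2 / nu1_star m n)\<rceil>)"

lemma threshold_mono:
  assumes "m \<le> m'" "n \<le> n'"
  shows "threshold m n \<le> threshold m' n'"
  unfolding threshold_def
  using nu1_star_antimono[OF assms] nu1_star_pos
  by (intro running_max_mono nat_mono ceiling_mono max.mono frac_le) auto

lemma threshold_gap:
  assumes "threshold m n \<le> k"
  shows "1 - t k \<le> nu1_star m n / (8 * (real b)\<^sup>2)"
proof -
  let ?\<nu> = "nu1_star m n"
  define K where "K = nat \<lceil>max (2 * real b / sqrt ?\<nu>) (8 * (real b)\<^sup>2 / ?\<nu>)\<rceil>"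
  have pos: "0 < 8 * (real b)\<^sup>2 / ?\<nu>" using b nu1_star_pos[of m n] by simp
  have "8 * (real b)\<^sup>2 / ?\<nu> \<le> K" unfolding K_def by linarith
  have "\<alpha> K \<le> k" using assms running_max_ge[of K K \<alpha>] by (simp add: threshold_def K_def)
  then have "1 - t k \<le> 1 / (real K + 1)" using alpha by fastforce
  also have "\<dots> \<le> 1 / (8 * (real b)\<^sup>2 / ?\<nu>)"
    using pos \<open>8 * (real b)\<^sup>2 / ?\<nu> \<le> K\<close> by (intro frac_le) auto
  finally show ?thesis by simp
qed

text \<open>Beyond the threshold \<open>1 - t c\<close> would be smaller than
  \<open>1 / \<gamma> c\<close>, against \<open>t_gamma\<close>. So the threshold exceeds all
  indices over which \<open>nu1_star\<close> is a minimum.\<close>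

lemma threshold_ge:
  assumes "c \<le> max m (n + running_max g n)"
  shows "c < threshold m n"
proof (rule ccontr)
  assume "\<not> c < threshold m n"
  then have "1 - t c \<le> nu1_star m n / (8 * (real b)\<^sup>2)" by (intro threshold_gap) simp
  also have "\<dots> \<le> nu1_star m n"
  proof -
    have "1 \<le> (real b)\<^sup>2" using b by simp
    then have "1 \<le> 8 * (real b)\<^sup>2" by linarith
    then show ?thesis using nu1_star_pos[of m n] b by (simp add: divide_le_eq)
  qed
  also have "\<dots> < psi (theta_tilde (beta c))" using nu1_star_le[OF assms] nu1_star_pos[of m n] by simp
  also have "\<dots> \<le> (theta_tilde (beta c))\<^sup>2 / 48"
  proof (intro psi_le[OF convexity b] theta_tilde_bounds)
    have "1 / (4 * real (\<gamma> c)) \<le> 1" using gamma[of c] by (simp add: field_simps)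
    then have "theta_tilde (beta c) \<le> 1" using theta_tilde_le[of c] by linarith
    then show "theta_tilde (beta c) \<le> real (4 * b)" using b by simp
  qed
  also have "\<dots> \<le> 1 / real (\<gamma> c)"
  proof -
    have "(theta_tilde (beta c))\<^sup>2 \<le> (1 / (4 * real (\<gamma> c))) * 1"
      unfolding power2_eq_square using theta_tilde_le[of c] theta_tilde_bounds(1)[of c] gamma[of c]
      by (intro mult_mono order_trans[OF theta_tilde_le]) (auto simp: field_simps)
    then show ?thesis using gamma[of c] by (simp add: field_simps)
  qed
  finally show False using t_gamma[of c] by simp
qed

lemma threshold_residual:
  assumes "threshold m n \<le> k"
  shows "norm (X k - T (X k)) \<le> nu1_star m n / (8 * real b)"
proof -
  have "X k - T (X k) = (1 - t k) *\<^sub>R (x - T (X k))"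
    by (subst (1) X(2)) (simp add: algebra_simps)
  then have "norm (X k - T (X k)) = (1 - t k) * norm (x - T (X k))" using t[of k] by simp
  also have "\<dots> \<le> (nu1_star m n / (8 * (real b)\<^sup>2)) * b"
    using threshold_gap[OF assms] diff_le[OF x T_in[OF X(1)]] nu1_star_pos[of m n] t[of k]
    by (intro mult_mono) auto
  finally show ?thesis using b by (simp add: power2_eq_square)
qed

end

context pseudocontraction_approximants
begin

subsection \<open>Approximate centres are approximate fixed points\<close>

text \<open>
  Instead of the resolvent of \<open>I - T\<close> at \<open>v\<close>, whose existence would need a surjectivity theorem for
  accretive operators, an Euler polygon of the flow \<open>y' = T y - y\<close> on \<open>[0,1]\<close> is used.
\<close>

primrec euler :: "real \<Rightarrow> 'a \<Rightarrow> nat \<Rightarrow> 'a" where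
  "euler s v 0 = v"
| "euler s v (Suc k) = (1 - s) *\<^sub>R euler s v k + s *\<^sub>R T (euler s v k)"

lemma euler_in:
  assumes "v \<in> C" "0 \<le> s" "s \<le> 1"
  shows "euler s v k \<in> C"
  using assms convexD_alt[OF convex_C] T_in by (induction k) auto

text \<open>A step from \<open>y\<close> adds \<open>s *\<^sub>R (y - T y)\<close> to
  \<open>z - y\<close>. The growth of the square is controlled by \<open>dual\<close> at the new
  point; as the step is small, this returns to \<open>z - y\<close> at cost \<open>\<sigma>\<close>,
  where accretivity bounds it by the residual of \<open>z\<close>.\<close>

lemma euler_distance:
  fixes s \<sigma> \<kappa> :: real
  assumes v: "v \<in> C" and s: "0 < s" "s \<le> 1" and "0 < \<sigma>" "s * b \<le> omega \<sigma>"
    and z: "z \<in> C" "norm (z - T z) \<le> \<kappa>"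
  shows "(norm (z - euler s v k))\<^sup>2 \<le> (norm (z - v))\<^sup>2 + k * (2 * s * b * (\<kappa> + \<sigma>))"
proof (induction k)
  case (Suc k)
  define y where "y = euler s v k"
  have y: "y \<in> C" using euler_in v s by (simp add: y_def)
  have next_in: "euler s v (Suc k) \<in> C" using euler_in v s by (meson less_imp_le)
  have eq: "z - euler s v (Suc k) = (z - y) + s *\<^sub>R (y - T y)"
    by (simp add: y_def algebra_simps)
  have Fy: "norm (y - T y) \<le> b" using diff_le y T_in by simp
  have "dual (z - euler s v (Suc k)) (y - T y) \<le> dual (z - y) (y - T y) + \<sigma> * norm (y - T y)"
  proof (rule dual_close[OF \<open>0 < \<sigma>\<close> z(1) next_in z(1) y])
    have "norm ((z - euler s v (Suc k)) - (z - y)) = s * norm (y - T y)"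
      unfolding eq using s by simp
    also have "\<dots> \<le> s * b" using Fy s by (intro mult_left_mono) auto
    finally show "norm ((z - euler s v (Suc k)) - (z - y)) \<le> omega \<sigma>" using assms by simp
  qed
  also have "\<sigma> * norm (y - T y) \<le> b * \<sigma>"
    using mult_left_mono[OF Fy, of \<sigma>] \<open>0 < \<sigma>\<close> by (simp add: mult.commute)
  also have "dual (z - y) (y - T y) \<le> dual (z - y) (z - T z)"
    using accretive[OF z(1) y] by (simp add: dual_diff)
  also have "dual (z - y) (z - T z) \<le> b * \<kappa>"
    using dual_bound[OF z(1) y, of "z - T z"] mult_left_mono[OF z(2), of b] by simp
  finally have "dual (z - euler s v (Suc k)) (y - T y) \<le> b * (\<kappa> + \<sigma>)" by (simp add: algebra_simps)
  then have "s * dual (z - euler s v (Suc k)) (y - T y) \<le> s * (b * (\<kappa> + \<sigma>))"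
    using s by (intro mult_left_mono) auto
  moreover have "(norm (z - euler s v (Suc k)))\<^sup>2
      \<le> (norm (z - y))\<^sup>2 + 2 * dual (z - euler s v (Suc k)) (s *\<^sub>R (y - T y))"
    unfolding eq by (rule norm_square_add_le[OF smooth])
  ultimately have "(norm (z - euler s v (Suc k)))\<^sup>2 \<le> (norm (z - y))\<^sup>2 + 2 * s * b * (\<kappa> + \<sigma>)"
    by (simp add: dual_scale)
  moreover have "real (Suc k) * (2 * s * b * (\<kappa> + \<sigma>)) = real k * (2 * s * b * (\<kappa> + \<sigma>)) + 2 * s * b * (\<kappa> + \<sigma>)"
    by (simp add: distrib_right)
  ultimately show ?case using Suc.IH unfolding y_def by linarith
qed simp

text \<open>While the polygon stays within \<open>\<rho>\<close> of \<open>v\<close>, each step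
  differs from \<open>s *\<^sub>R (T v - v)\<close> by at most
  \<open>s * (e + \<rho>)\<close>.\<close>

lemma euler_drift:
  assumes v: "v \<in> C" and s: "0 < s" "s \<le> 1" and "\<And>j. j < k \<Longrightarrow> norm (euler s v j - v) \<le> \<rho>"
    and osc: "\<And>y. y \<in> C \<Longrightarrow> norm (y - v) \<le> \<rho> \<Longrightarrow> norm (T y - T v) \<le> e"
  shows "norm (euler s v k - v - (k * s) *\<^sub>R (T v - v)) \<le> k * s * (e + \<rho>)"
  using assms(4)
proof (induction k)
  case (Suc k)
  define y where "y = euler s v k"
  have y: "y \<in> C" using euler_in v s by (simp add: y_def)
  have "norm (y - v) \<le> \<rho>" using Suc.prems by (simp add: y_def)
  then have "norm (T y - T v) + norm (y - v) \<le> e + \<rho>" using osc[OF y] by simp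
  then have "norm ((T y - T v) - (y - v)) \<le> e + \<rho>"
    using norm_triangle_ineq4[of "T y - T v" "y - v"] by linarith
  then have step: "norm (s *\<^sub>R ((T y - T v) - (y - v))) \<le> s * (e + \<rho>)"
    using s by (simp add: mult_left_mono)
  have IH: "norm (y - v - (k * s) *\<^sub>R (T v - v)) \<le> k * s * (e + \<rho>)"
    using Suc unfolding y_def by simp
  have eq: "euler s v (Suc k) - v - (Suc k * s) *\<^sub>R (T v - v)
      = (y - v - (k * s) *\<^sub>R (T v - v)) + s *\<^sub>R ((T y - T v) - (y - v))"
    by (simp add: y_def algebra_simps)
  have "norm (euler s v (Suc k) - v - (Suc k * s) *\<^sub>R (T v - v)) \<le> k * s * (e + \<rho>) + s * (e + \<rho>)"
    unfolding eq by (rule norm_triangle_le[OF add_mono[OF IH step]])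
  then show ?case by (simp add: distrib_right)
qed simp

text \<open>Otherwise, by \<open>midpoint_psi\<close>, the midpoint of \<open>v\<close> and
  \<open>y\<close> would have squared distance below the radius from every
  \<open>Z n\<close>.\<close>

lemma centre_unique:
  assumes S: "finite S" "S \<noteq> {}" and Z: "\<And>n. n \<in> S \<Longrightarrow> Z n \<in> C" and vy: "v \<in> C" "y \<in> C"
    and v: "\<And>n. n \<in> S \<Longrightarrow> (norm (Z n - v))\<^sup>2 \<le> cheb_radius C Z S + e1"
    and y: "\<And>n. n \<in> S \<Longrightarrow> (norm (Z n - y))\<^sup>2 \<le> cheb_radius C Z S + e2"
    and "0 < s" "(e1 + e2) / 2 < psi s"
  shows "norm (v - y) < s"
proof (rule ccontr)
  assume "\<not> norm (v - y) < s"
  define m where "m = (1 - 1/2) *\<^sub>R v + (1/2) *\<^sub>R y"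
  have "m \<in> C" unfolding m_def using vy by (intro convexD_alt[OF convex_C]) auto
  then obtain n where n: "n \<in> S" "cheb_radius C Z S \<le> (norm (Z n - m))\<^sup>2"
    using cheb_radius_le[OF S] by blast
  have "Z n - m = ((Z n - v) + (Z n - y)) /\<^sub>R 2"
  proof -
    have "Z n = (1/2) *\<^sub>R Z n + (1/2) *\<^sub>R Z n" by (simp flip: scaleR_add_left)
    then show ?thesis by (simp add: m_def algebra_simps)
  qed
  moreover have "norm ((Z n - v) - (Z n - y)) \<ge> s"
    using \<open>\<not> norm (v - y) < s\<close> by (simp add: norm_minus_commute)
  then have "(norm (((Z n - v) + (Z n - y)) /\<^sub>R 2))\<^sup>2 + psi s
      \<le> (norm (Z n - v))\<^sup>2 / 2 + (norm (Z n - y))\<^sup>2 / 2"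
    using diff_le Z n vy by (intro midpoint_psi[OF convexity b \<open>0 < s\<close>]) auto
  ultimately show False using n v[of n] y[of n] assms(9) by (auto simp: field_simps)
qed

text \<open>Small residuals keep the Euler polygon from \<open>v\<close> an approximate centre up to
  time \<open>1\<close>, so \<open>centre_unique\<close> holds it near \<open>v\<close>. By then it
  has drifted by nearly \<open>T v - v\<close>, so this vector is short.\<close>

lemma centre_almost_fixed:
  assumes S: "finite S" "S \<noteq> {}" and Z: "\<And>n. n \<in> S \<Longrightarrow> Z n \<in> C"
    and residual: "\<And>n. n \<in> S \<Longrightarrow> norm (Z n - T (Z n)) \<le> \<nu> / (8 * real b)"
    and v: "v \<in> C" "\<And>n. n \<in> S \<Longrightarrow> (norm (Z n - v))\<^sup>2 \<le> cheb_radius C Z S + \<nu> / 8"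
    and "0 < \<nu>" and nu: "2 * \<nu> \<le> psi (theta_tilde (beta c))"
  shows "norm (T v - v) \<le> beta c"
proof -
  define \<sigma> where "\<sigma> = \<nu> / (8 * real b)"
  have \<sigma>: "0 < \<sigma>" using \<open>0 < \<nu>\<close> b by (simp add: \<sigma>_def)
  \<comment> \<open>The step size \<open>1 / K\<close> has to satisfy
    \<open>s * b \<le> omega \<sigma>\<close>; the summand \<open>1\<close> ensures
    \<open>1 < K\<close>.\<close>
  obtain K :: nat where K: "1 / omega \<sigma> * b + 1 < K" using reals_Archimedean2 by blast
  define s where "s = 1 / real K"
  have om: "0 < omega \<sigma>" using omega_pos' \<sigma> by simp
  then have "0 \<le> 1 / omega \<sigma> * b" by simp
  then have K1: "1 < real K" using K by linarith
  have s: "0 < s" "s \<le> 1" "K * s = 1" using K1 by (auto simp: s_def)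
  have "b / omega \<sigma> \<le> K" using K by simp
  then have sb: "s * b \<le> omega \<sigma>" using K1 om by (simp add: s_def field_simps)
  have near: "norm (euler s v k - v) \<le> theta_tilde (beta c)" if "k \<le> K" for k
  proof -
    have "norm (v - euler s v k) < theta_tilde (beta c)"
    \<comment> \<open>The excess consists of \<open>\<nu> / 8\<close> from \<open>v\<close> and at
      most \<open>\<nu> / 2\<close> accumulated up to time \<open>1\<close>.\<close>
    proof (rule centre_unique[OF S Z v(1) euler_in[OF v(1)] v(2), where ?e2.0 = "\<nu> * 5 / 8"])
      fix n assume n: "n \<in> S"
      have "(norm (Z n - euler s v k))\<^sup>2 \<le> (norm (Z n - v))\<^sup>2 + k * (2 * s * b * (\<nu> / (8 * real b) + \<sigma>))"
        using euler_distance[OF v(1) s(1,2) \<sigma> sb Z[OF n] residual[OF n]] .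
      also have "k * (2 * s * b * (\<nu> / (8 * real b) + \<sigma>)) = (k * s) * (\<nu> / 2)"
        using b by (simp add: \<sigma>_def field_simps)
      also have "(k * s) * (\<nu> / 2) \<le> 1 * (\<nu> / 2)"
        using \<open>k \<le> K\<close> s \<open>0 < \<nu>\<close> mult_right_mono[of "real k" "real K" s] by (intro mult_right_mono) auto
      finally show "(norm (Z n - euler s v k))\<^sup>2 \<le> cheb_radius C Z S + \<nu> * 5 / 8"
        using v(2)[OF n] by simp
    qed (use s theta_tilde_bounds nu \<open>0 < \<nu>\<close> in auto)
    then show ?thesis by (simp add: norm_minus_commute)
  qed
  have osc: "norm (T y - T v) \<le> beta c / 2" if "y \<in> C" "norm (y - v) \<le> theta_tilde (beta c)" for y
  proof -
    have "norm (y - v) \<le> \<theta> (beta c / 2)" using that(2) theta_tilde_bounds(3)[of c] by linarith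
    moreover have "0 < beta c / 2" using beta_pos[of c] by simp
    ultimately show ?thesis
      using cont that(1) v(1) unfolding modulus_uniform_continuity_on_def by blast
  qed
  have "norm (euler s v K - v - (K * s) *\<^sub>R (T v - v)) \<le> K * s * (beta c / 2 + theta_tilde (beta c))"
    using near osc by (intro euler_drift[OF v(1) s(1,2)]) auto
  then have "norm (euler s v K - v - (T v - v)) \<le> beta c / 2 + theta_tilde (beta c)"
    using s by simp
  then show ?thesis
    using near[of K] theta_tilde_bounds(2)[of c]
      norm_triangle_sub[of "T v - v" "euler s v K - v"]
    by (simp add: norm_minus_commute)
qed

subsection \<open>Variational inequalities at a centre\<close>

text \<open>The equation for \<open>X c\<close> makes \<open>X c - x\<close> a multiple of
  \<open>T (X c) - X c\<close>, which accretivity replaces by \<open>T v - v\<close>. The factor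
  \<open>\<mu>\<close> is at most \<open>\<gamma> c\<close>, and \<open>beta\<close> is defined to
  compensate it.\<close>

lemma approximant_inequality:
  assumes "v \<in> C" "norm (T v - v) \<le> beta c"
  shows "dual (X c - v) (X c - x) \<le> p0 / 2"
proof -
  define \<mu> where "\<mu> = t c / (1 - t c)"
  have tc: "0 < 1 - t c" using t[of c] by simp
  have \<mu>0: "0 < \<mu>" using t[of c] by (simp add: \<mu>_def)
  have "1 / real (\<gamma> c) \<le> 1 - t c" using t_gamma[of c] by simp
  then have "1 \<le> (1 - t c) * \<gamma> c" using gamma[of c] by (simp add: pos_divide_le_eq)
  then have \<mu>: "\<mu> \<le> \<gamma> c" using tc t[of c] by (simp add: \<mu>_def pos_divide_le_eq mult.commute)
  have "(1 - t c) *\<^sub>R (X c - x) = t c *\<^sub>R (T (X c) - X c)"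
  proof -
    have "X c - x = t c *\<^sub>R (T (X c) - x)" by (subst X(2)) (simp add: algebra_simps)
    then have "T (X c) - X c = (1 - t c) *\<^sub>R (T (X c) - x)"
      by (metis (no_types, lifting) add_diff_cancel_left' diff_add_cancel diff_diff_eq2 scaleR_left_diff_distrib scaleR_one)
    then show ?thesis using \<open>X c - x = _\<close> by (simp add: mult.commute)
  qed
  then have "(1 / (1 - t c)) *\<^sub>R ((1 - t c) *\<^sub>R (X c - x)) = (1 / (1 - t c)) *\<^sub>R (t c *\<^sub>R (T (X c) - X c))"
    by simp
  then have "X c - x = \<mu> *\<^sub>R (T (X c) - X c)" using tc by (simp add: \<mu>_def)
  then have "dual (X c - v) (X c - x) = \<mu> * dual (X c - v) (T (X c) - X c)"
    by (simp add: dual_scale)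
  also have "\<dots> \<le> \<mu> * (b * beta c)"
  proof (intro mult_left_mono)
    have "dual (X c - v) (T (X c) - X c) \<le> dual (X c - v) (T v - v)"
      using accretive[OF X(1) assms(1), of c] by (simp add: dual_diff)
    also have "\<dots> \<le> b * beta c"
      using dual_bound[OF X(1) assms(1), of c "T v - v"] mult_left_mono[OF assms(2), of b] by simp
    finally show "dual (X c - v) (T (X c) - X c) \<le> b * beta c" .
  qed (use \<mu>0 in simp)
  also have "\<dots> \<le> \<gamma> c * (b * beta c)"
    using \<mu> beta_pos[of c] by (intro mult_right_mono) auto
  also have "\<dots> = b * (beta c * \<gamma> c)" by simp
  also have "\<dots> = p0 / 2" using b by (simp add: beta_gamma)
  finally show ?thesis .
qed

lemma approximant_inequality_near:
  assumes "v \<in> C" "w \<in> C" "norm (T v - v) \<le> beta c" "norm (w - v) \<le> omega (p0 / (2 * real b))"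
  shows "dual (X c - w) (X c - x) \<le> p0"
proof -
  have "0 < p0 / (2 * real b)" using p0_pos b by simp
  then have "dual (X c - w) (X c - x) \<le> dual (X c - v) (X c - x) + p0 / (2 * real b) * norm (X c - x)"
    using assms X(1) by (intro dual_close) (auto simp: norm_minus_commute)
  also have "p0 / (2 * real b) * norm (X c - x) \<le> p0 / (2 * real b) * b"
    using diff_le[OF X(1) x] p0_pos by (intro mult_left_mono) auto
  also have "\<dots> = p0 / 2" using b by simp
  finally show ?thesis using approximant_inequality[OF assms(1,3)] by simp
qed

lemma towards_anchor_in:
  assumes "w \<in> C"
  shows "w + delta *\<^sub>R (x - w) \<in> C"
proof -
  have "(1 - delta) *\<^sub>R w + delta *\<^sub>R x \<in> C"
    using assms x delta_pos by (intro convexD_alt[OF convex_C]) (auto simp: delta_def)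
  then show ?thesis by (simp add: algebra_simps)
qed

text \<open>By \<open>test\<close>, moving \<open>w\<close> towards \<open>x\<close> to
  \<open>q\<close> gains at most \<open>u0\<close>. The subgradient inequality at
  \<open>z - q\<close> turns this into a bound there, and \<open>delta\<close> is small enough to
  return to \<open>z - w\<close> at cost \<open>nu4 / 3\<close>.\<close>

lemma anchor_inequality:
  assumes "w \<in> C" "z \<in> C"
    and test: "(norm (z - w))\<^sup>2 \<le> (norm (z - (w + delta *\<^sub>R (x - w))))\<^sup>2 + u0"
  shows "dual (z - w) (x - w) \<le> 2 * nu4 / 3"
proof -
  define q where "q = w + delta *\<^sub>R (x - w)"
  have q: "q \<in> C" using towards_anchor_in[OF assms(1)] by (simp add: q_def)
  have xw: "norm (x - w) \<le> b" using diff_le x assms by simp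
  have "(norm (z - q))\<^sup>2 + 2 * dual (z - q) (delta *\<^sub>R (x - w)) \<le> (norm (z - q + delta *\<^sub>R (x - w)))\<^sup>2"
    by (rule dual_subgradient)
  also have "z - q + delta *\<^sub>R (x - w) = z - w" by (simp add: q_def)
  finally have "2 * delta * dual (z - q) (x - w) \<le> u0"
    using test by (simp add: dual_scale q_def)
  also have "u0 \<le> 2 * nu4 * delta / 3" by (simp add: u0_def)
  finally have 1: "dual (z - q) (x - w) \<le> nu4 / 3" using delta_pos by (simp add: field_simps)
  have "0 < nu4 / (3 * real b)" using nu4_pos b by simp
  then have "dual (z - w) (x - w) \<le> dual (z - q) (x - w) + nu4 / (3 * real b) * norm (x - w)"
  proof (rule dual_close[OF _ assms(2,1) assms(2) q])
    have "norm ((z - w) - (z - q)) = delta * norm (x - w)" using delta_pos by (simp add: q_def)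
    also have "\<dots> \<le> omega (nu4 / (3 * real b)) / b * b"
      using xw omega_pos'[OF \<open>0 < nu4 / (3 * real b)\<close>]
      by (intro mult_mono) (auto simp: delta_def)
    finally show "norm ((z - w) - (z - q)) \<le> omega (nu4 / (3 * real b))" using b by simp
  qed
  also have "nu4 / (3 * real b) * norm (x - w) \<le> nu4 / (3 * real b) * b"
    using xw nu4_pos by (intro mult_left_mono) auto
  also have "\<dots> = nu4 / 3" using b by simp
  finally show ?thesis using 1 by simp
qed

lemma near_centre:
  assumes "dual (X c - w) (x - w) \<le> 2 * nu4 / 3" "dual (X c - w) (X c - x) \<le> p0"
  shows "(norm (X c - w))\<^sup>2 \<le> nu4"
proof -
  have "(norm (X c - w))\<^sup>2 = dual (X c - w) (X c - x) + dual (X c - w) (x - w)"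
    by (simp add: dual_self flip: dual_add)
  moreover have "p0 \<le> nu4 / 3" by (simp add: p0_def)
  ultimately show ?thesis using assms by simp
qed

text \<open>Replacing \<open>X c\<close> by \<open>w\<close> and \<open>X d\<close> by
  \<open>w'\<close> in the two inequalities costs \<open>\<epsilon>\<^sup>2 / 48\<close> each; the
  sum of the results bounds the square of \<open>norm (w - w')\<close>.\<close>

lemma centres_close:
  assumes w: "w \<in> C" "w' \<in> C" and c: "(norm (X c - w))\<^sup>2 \<le> nu4" "(norm (X d - w'))\<^sup>2 \<le> nu4"
    and ineq: "dual (X c - w') (X c - x) \<le> p0" "dual (X d - w) (X d - x) \<le> p0"
  shows "norm (X c - X d) \<le> \<epsilon>"
proof -
  define r where "r = \<epsilon>\<^sup>2 / (96 * real b)"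
  have r: "0 < r" using eps b by (simp add: r_def)
  have root: "norm (X k - z) \<le> a" if "(norm (X k - z))\<^sup>2 \<le> nu4" "nu4 \<le> a\<^sup>2" "0 \<le> a" for k z a
    using that by (meson order_trans power2_le_imp_le)
  have "r\<^sup>2 = \<epsilon> ^ 4 / (9216 * (real b)\<^sup>2)" by (simp add: r_def power_divide power_mult_distrib)
  then have nu4: "nu4 \<le> r\<^sup>2" "nu4 \<le> (omega r)\<^sup>2" "nu4 \<le> (\<epsilon> / 4)\<^sup>2"
    using nu4_bounds by (auto simp: r_def power_divide)
  have half: "dual (w - w') (w - x) \<le> \<epsilon>\<^sup>2 / 32"
    if w: "w \<in> C" "w' \<in> C" and c: "(norm (X c - w))\<^sup>2 \<le> nu4" and "dual (X c - w') (X c - x) \<le> p0"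
    for w w' c
  proof -
    have close: "norm (X c - w) \<le> r" "norm (X c - w) \<le> omega r"
      using root[OF c] nu4 r omega_pos'[OF r] by auto
    have "dual (w - w') (w - x) \<le> dual (X c - w') (w - x) + r * norm (w - x)"
      using w X(1) close by (intro dual_close r) (auto simp: norm_minus_commute)
    also have "r * norm (w - x) \<le> r * b" using diff_le[OF w(1) x] r by (intro mult_left_mono) auto
    also have "dual (X c - w') (w - x) = dual (X c - w') (X c - x) + dual (X c - w') (w - X c)"
      by (simp flip: dual_add)
    also have "dual (X c - w') (w - X c) \<le> b * r"
      using dual_bound[OF X(1) w(2), of c "w - X c"] mult_left_mono[OF close(1), of b]
      by (simp add: norm_minus_commute)
    also have "dual (X c - w') (X c - x) \<le> \<epsilon>\<^sup>2 / 96" using that(4) by (simp add: p0_def)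
    finally have "dual (w - w') (w - x) \<le> \<epsilon>\<^sup>2 / 96 + 2 * (b * r)" by (simp add: mult.commute)
    also have "b * r = \<epsilon>\<^sup>2 / 96" using b by (simp add: r_def)
    finally show ?thesis by simp
  qed
  have "(norm (w - w'))\<^sup>2 = dual (w - w') (w - x) + dual (w' - w) (w' - x)"
  proof -
    have "dual (w' - w) (w' - x) = dual (w - w') (x - w')"
    proof -
      have neg: "dual (- y) h = dual y (- h)" for y h :: 'a
      proof -
        have "norm (- y + l *\<^sub>R h) = norm (y + l *\<^sub>R (- h))" for l
          using norm_minus_cancel[of "y + l *\<^sub>R (- h)"] by simp
        then show ?thesis by (simp only: dual_def dual_quotient_def norm_minus_cancel)
      qed
      show ?thesis using neg[of "w - w'" "w' - x"] by simp
    qed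
    then show ?thesis by (simp add: dual_self flip: dual_add)
  qed
  also have "\<dots> \<le> (\<epsilon> / 4)\<^sup>2" using half[OF w c(1) ineq(1)] half[OF w(2,1) c(2) ineq(2)]
    by (simp add: power_divide)
  finally have "norm (w - w') \<le> \<epsilon> / 4" by (rule power2_le_imp_le) (use eps in simp)
  moreover have "norm (X c - w) \<le> \<epsilon> / 4" "norm (X d - w') \<le> \<epsilon> / 4"
    using root[OF c(1) nu4(3)] root[OF c(2) nu4(3)] eps by simp_all
  moreover have "norm (X c - X d) \<le> norm (X c - w) + norm (w - w') + norm (X d - w')"
    using norm_triangle_ineq[of "(X c - w) + (w - w')" "w' - X d"]
      norm_triangle_ineq[of "X c - w" "w - w'"]
    by (simp add: norm_minus_commute)
  ultimately show ?thesis using eps by linarith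
qed

end

subsection \<open>Lower bounds for the rate\<close>

definition six4 :: "six \<Rightarrow> nat" where
  "six4 z = (case z of (z1, z2, z3, z4, z5, z6) \<Rightarrow> z4)"

lemma six4_sup: "six4 (sup y z) = max (six4 y) (six4 z)"
  by (cases y; cases z) (simp add: six4_def sup_max)

lemma six6_sup: "six6 (sup y z) = max (six6 y) (six6 z)"
  by (cases y; cases z) (simp add: six6_def sup_max)

lemma six4_Xi: "six4 (Xi \<xi> \<xi>' GF x y z) = six4 (GF x y (fst z, snd z + \<xi> x y z))"
  by (simp add: Xi_def six4_def split: prod.split)

lemma six6_Xi: "six6 (Xi \<xi> \<xi>' GF x y z) = \<xi>' x y z + six6 (GF x y (fst z, snd z + \<xi> x y z))"
  by (simp add: Xi_def six6_def split: prod.split)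

context metastability_rate
begin

section \<open>Segment lengths encoded in the rate\<close>

definition same_data :: "point \<Rightarrow> point \<Rightarrow> bool" where
  "same_data x x' \<longleftrightarrow> first_functional (fst x) = first_functional (fst x') \<and>
     second_functional (fst x) = second_functional (fst x') \<and> snd x = snd x'"

text \<open>With the recursion of \<open>MU\<close> this makes the second functional of each level a
  function of its last argument alone, which \<open>seg\<close> records.\<close>

lemma GF_w_cong:
  assumes "same_data x x'"
  shows "GF_w x = GF_w x'"
proof -
  have [simp]: "U1 x = U1 x'" "M1 x = M1 x'" "U2 x = U2 x'" "M2 x = M2 x'" "snd x = snd x'"
    using assms by (simp_all add: same_data_def U1_def M1_def U2_def M2_def fun_eq_iff)
  have [simp]: "GF0 x = GF0 x'" by (simp add: GF0_def)
  then have [simp]: "u' x = u' x'" "iota x = iota x'"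
    by (simp_all add: u'_def iota_def k_tilde_def fun_eq_iff)
  have [simp]: "GF1 x = GF1 x'" "GF2 x = GF2 x'" by (simp_all add: GF1_def GF2_def fun_eq_iff)
  have [simp]: "GF1_tilde x = GF1_tilde x'" "GF2_tilde x = GF2_tilde x'" "GF3_tilde x = GF3_tilde x'"
    "GF2_tilde' x = GF2_tilde' x'" "GF3_tilde' x = GF3_tilde' x'"
    by (simp_all add: GF1_tilde_def GF2_tilde_def GF3_tilde_def GF2_tilde'_def GF3_tilde'_def
        Xi_def xi0_def xi1_def xi2_def xi2'_def fun_eq_iff)
  have [simp]: "a_v x = a_v x'" "a_v' x = a_v' x'"
    by (simp_all add: a_v_def a_v'_def GF_v_def GF_v'_def fun_eq_iff)
  have [simp]: "a_w' x = a_w' x'" by (simp add: a_w'_def GF_w'_def)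
  show ?thesis by (simp add: GF_w_def)
qed

definition seg :: "nat \<Rightarrow> nat \<Rightarrow> nat" where
  "seg i m = snd (MU GF_w i) 0 0 (\<lambda>_. 0) m"

definition level_point :: "nat \<Rightarrow> nat \<Rightarrow> point" where
  "level_point i m = ((fst (MU GF_w i), snd (MU GF_w i), 0, 0, \<lambda>_. 0), m)"

lemma snd_level_point [simp]: "snd (level_point i m) = m"
  by (simp add: level_point_def)

lemma snd_MU_eq_seg: "snd (MU GF_w i) p y L m = seg i m"
proof (cases i)
  case (Suc j)
  then show ?thesis
    by (auto simp: seg_def same_data_def first_functional_def second_functional_def
        intro!: arg_cong[where f = six6] GF_w_cong)
qed (simp add: seg_def)

lemma second_level_point: "second_functional (fst (level_point i m)) p y L k = seg i k"
  by (simp add: second_functional_def level_point_def snd_MU_eq_seg)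

lemma seg_Suc: "seg (Suc i) m = six6 (GF_w (level_point i m))"
  by (simp add: seg_def level_point_def)

text \<open>The iteration count \<open>b\<^sup>2 * (K + 1)\<close> is positive, so one unrolling of
  \<open>W\<close> exposes \<open>U\<close>.\<close>

lemma NN_eq:
  assumes "b \<ge> 1"
  obtains n where "NN U M K y = U (W U n) y n"
proof -
  have "b\<^sup>2 * (K + 1) \<noteq> 0" using assms by simp
  then obtain n where "b\<^sup>2 * (K + 1) = Suc n" by (metis not0_implies_Suc)
  then show ?thesis using that by (simp add: NN_def)
qed

lemma TT_ge:
  assumes "b \<ge> 1" "\<And>r1 r2 r3. k \<le> M r1 r2 r3"
  shows "k \<le> TT U M K"
proof -
  have "b\<^sup>2 * (K + 1) \<noteq> 0" using assms by simp
  then obtain n where "b\<^sup>2 * (K + 1) = Suc n" by (metis not0_implies_Suc)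
  then show ?thesis using assms by (simp add: TT_def)
qed

lemma I_pos:
  assumes "b \<ge> 1"
  obtains j where "I l = Suc j"
proof -
  have "I l \<noteq> 0" using assms by (simp add: I_def)
  then show ?thesis using that by (metis not0_implies_Suc)
qed

text \<open>All tuples joined in \<open>Psi_tilde\<close> carry the same functionals, so the
  supremum leaves these unchanged.\<close>

lemma second_Psi: "second_functional (fst (Psi l Om)) = snd (MU Om (I l))"
proof -
  have "second_functional (fst (Psi_tilde l Om i)) = snd (MU Om (I l))" for i
    by (cases i) (simp_all add: Psi_start_def second_functional_def split: prod.split)
  then show ?thesis by (simp add: Psi_def)
qed

lemma snd_Psi_ge:
  assumes "b \<ge> 1" "\<And>s. k \<le> six4 (Om s)"
  shows "k \<le> snd (Psi l Om)"
proof -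
  obtain j where j: "I l = Suc j" using I_pos[OF assms(1)] .
  show ?thesis
    using assms(2)[of "Psi_tilde l Om j"]
    by (simp add: Psi_def j six4_def sup_max Psi_start_def split: prod.splits)
qed

lemma six6_GF0_ge:
  assumes "b \<ge> 1"
  obtains r1 r3 where "second_functional (fst x) r3 b r1 (snd x) \<le> six6 (GF0 x)"
proof -
  obtain n where "NN (U1 x) (M1 x) (nat \<lceil>4 / u0\<rceil>) (snd x) = U1 x (W (U1 x) n) (snd x) n"
    using NN_eq[OF assms] .
  then have "second_functional (fst x) n b (W (U1 x) n) (snd x) \<le> six6 (GF0 x)"
    by (simp add: GF0_def six6_def Let_def U1_def)
  then show ?thesis using that by blast
qed

lemma six6_GF2_ge:
  assumes "b \<ge> 1"
  obtains r1 r3 where "second_functional (fst x) r3 b r1 (snd z) \<le> six6 (GF2 x y z)"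
proof -
  let ?K = "nat \<lceil>4 / min u0 (u' x y)\<rceil>"
  obtain n where "NN (U2 x z) (M2 x z) ?K (snd z) = U2 x z (W (U2 x z) n) (snd z) n"
    using NN_eq[OF assms] .
  then have "second_functional (fst x) n b (W (U2 x z) n) (snd z) \<le> six6 (GF2 x y z)"
    by (simp add: GF2_def six6_def Let_def U2_def)
  then show ?thesis using that by blast
qed

lemma six4_GF1_tilde_ge:
  assumes "b \<ge> 1"
  shows "iota x y \<le> six4 (GF1_tilde x y z)"
proof -
  have "snd s \<le> six4 (GF1 x y s)" for s
    using TT_ge[OF assms, of "snd s" "M1 s"] by (simp add: GF1_def six4_def Let_def M1_def)
  from this[of "(fst z, snd z + iota x y)"] show ?thesis
    by (simp add: GF1_tilde_def six4_Xi xi1_def)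
qed

lemma snd_a_v_ge: "b \<ge> 1 \<Longrightarrow> iota x y \<le> snd (a_v x y)"
  unfolding a_v_def using six4_GF1_tilde_ge
  by (intro snd_Psi_ge) (auto simp: GF_v_def six4_sup le_max_iff_disj)

lemma snd_a_v'_ge: "b \<ge> 1 \<Longrightarrow> iota x y \<le> snd (a_v' x y)"
  unfolding a_v'_def using six4_GF1_tilde_ge
  by (intro snd_Psi_ge) (auto simp: GF_v'_def six4_sup le_max_iff_disj)

lemma k_tilde_level_ge:
  assumes "b \<ge> 1" "\<And>p y L k. second_functional (fst x) p y L k = seg i k"
  shows "snd x + seg i (snd x) \<le> k_tilde x"
  using six6_GF0_ge[OF assms(1), of x] assms(2) by (metis add_left_mono k_tilde_def)

text \<open>One unrolling of the second functional of \<open>a_w' x\<close> evaluates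
  \<open>GF_w'\<close>, hence \<open>GF3_tilde'\<close> at a value of \<open>a_v'\<close>. The
  witness \<open>l\<close> is the number of that value shifted by the number of
  \<open>a_w' x\<close>.\<close>

lemma k_tilde_a_w'_ge:
  assumes "b \<ge> 1" and x: "\<And>p y L k. second_functional (fst x) p y L k = seg i k"
  obtains y l where "iota x y \<le> l" "l + seg i l \<le> k_tilde (a_w' x)"
proof -
  define w where "w = a_w' x"
  obtain j where j: "I (nat \<lceil>1 / u0\<rceil>) = Suc j" using I_pos[OF assms(1)] .
  obtain r1 r3 where r: "second_functional (fst w) r3 b r1 (snd w) \<le> six6 (GF0 w)"
    using six6_GF0_ge[OF assms(1)] .
  \<comment> \<open>The point one level lower at which \<open>MU\<close> evaluates
    \<open>GF_w' x\<close> when called from \<open>GF0 w\<close>.\<close>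
  define z where "z = ((fst (MU (GF_w' x) j), snd (MU (GF_w' x) j), r3, b, r1), snd w)"
  define v where "v = a_v' x z"
  have "second_functional (fst w) r3 b r1 (snd w) = six6 (GF_w' x z)"
    by (simp add: w_def a_w'_def second_Psi j z_def)
  also have "\<dots> \<ge> six6 (GF3_tilde' x z v)" by (simp add: GF_w'_def six6_sup v_def)
  finally have 1: "six6 (GF3_tilde' x z v) \<le> six6 (GF0 w)" using r by simp
  have "seg i (snd v + snd w) \<le> six6 (GF2 x z (fst v, snd v + snd w))"
    using six6_GF2_ge[OF assms(1), of x "(fst v, snd v + snd w)" z] x by (metis snd_conv)
  then have "snd v + seg i (snd v + snd w) \<le> six6 (GF0 w)"
    using 1 by (simp add: GF3_tilde'_def six6_Xi xi0_def xi2'_def z_def)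
  then have "(snd v + snd w) + seg i (snd v + snd w) \<le> k_tilde w" by (simp add: k_tilde_def)
  moreover have "iota x z \<le> snd v + snd w" using snd_a_v'_ge[OF assms(1), of x z] by (simp add: v_def)
  ultimately show ?thesis using that w_def by blast
qed

end

context pseudocontraction_approximants
begin

lemma iota_eq: "iota y z = threshold (k_tilde y) (k_tilde z)"
  by (simp add: iota_def threshold_def Let_def)

lemma iota_ge: "k_tilde y \<le> iota y z"
  using threshold_ge[of "k_tilde y" "k_tilde y" "k_tilde z"] by (simp add: iota_eq)

lemma seg_step: "seg i m \<le> seg (Suc i) m"
  using six6_GF0_ge[OF b, of "level_point i m"]
  by (metis GF_w_def max.cobounded1 order_trans second_level_point seg_Suc six6_sup snd_level_point)

text \<open>The late segment \<open>E\<close> starts at \<open>m + k\<close>, where \<open>k\<close>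
  is the number of a value of \<open>a_v\<close> and therefore at least \<open>iota\<close>. The
  witness \<open>l\<close>, from \<open>k_tilde_a_w'_ge\<close>, starts the interval kept for the
  second sequence, not before the end of \<open>A\<close>.\<close>

lemma seg_tail:
  "\<exists>k l. k + seg i (m + k) \<le> seg (Suc i) m \<and> m + seg i m \<le> l \<and> threshold 0 (l + seg i l) \<le> k"
proof -
  define y where "y = level_point i m"
  have seg: "second_functional (fst y) p q L k = seg i k" for p q L k
    by (simp add: y_def second_level_point)
  obtain z l where l: "iota y z \<le> l" "l + seg i l \<le> k_tilde (a_w' y)"
    using k_tilde_a_w'_ge[OF b seg] .
  define v where "v = a_v y (a_w' y)"
  have "m + seg i m \<le> k_tilde y" using k_tilde_level_ge[OF b seg] by (simp add: y_def)
  then have "m + seg i m \<le> l" using iota_ge[of y z] l by linarith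
  moreover have "threshold 0 (l + seg i l) \<le> snd v"
    using threshold_mono[OF _ l(2), of 0 "k_tilde y"] snd_a_v_ge[OF b, of y "a_w' y"]
    by (simp add: iota_eq v_def)
  moreover have "snd v + seg i (m + snd v) \<le> seg (Suc i) m"
  proof -
    have "seg i (snd v + m) \<le> six6 (GF2 y (a_w' y) (fst v, snd v + m))"
      using six6_GF2_ge[OF b, of y "(fst v, snd v + m)" "a_w' y"] seg by (metis snd_conv)
    then have "snd v + seg i (snd v + m) \<le> six6 (GF3_tilde y (a_w' y) v)"
      by (simp add: GF3_tilde_def six6_Xi xi0_def xi2_def y_def)
    also have "\<dots> \<le> seg (Suc i) m"
      unfolding seg_Suc y_def[symmetric] v_def GF_w_def six6_sup by simp
    finally show ?thesis by (simp add: add.commute)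
  qed
  ultimately show ?thesis by blast
qed

lemma Theta'_ge: "\<exists>m. m + seg (I (nat \<lceil>1 / u0\<rceil>)) m \<le> Theta'"
proof -
  define y where "y = Psi (nat \<lceil>1 / u0\<rceil>) GF_w"
  have seg: "second_functional (fst y) p q L k = seg (I (nat \<lceil>1 / u0\<rceil>)) k" for p q L k
    by (simp add: y_def second_Psi snd_MU_eq_seg)
  obtain z l where l: "iota y z \<le> l" "l + seg (I (nat \<lceil>1 / u0\<rceil>)) l \<le> k_tilde (a_w' y)"
    using k_tilde_a_w'_ge[OF b seg] .
  have "snd y + seg (I (nat \<lceil>1 / u0\<rceil>)) (snd y) \<le> k_tilde (a_w' y)"
    using k_tilde_level_ge[OF b seg] iota_ge[of y z] l by linarith
  then show ?thesis by (auto simp: Theta'_def Let_def y_def k_tilde_def)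
qed

subsection \<open>Stable segments produce good centres\<close>

definition horizon :: "nat \<Rightarrow> nat" where
  "horizon N = N + running_max g N"

text \<open>\<open>h\<close> will be the identity first and then a choice of indices far from a
  fixed approximant. The index \<open>c\<close> in \<open>A\<close> is one for which moving
  \<open>w\<close> towards \<open>x\<close> hardly helps; the interval from \<open>l\<close> to
  \<open>l + seg i l\<close> is left for the second sequence.\<close>

lemma good_centre:
  assumes h: "\<And>n. n \<le> h n"
    and L: "b\<^sup>2 * (nat \<lceil>1 / u0\<rceil> + 1) \<le> L"
  obtains i n l c w where "L \<le> b\<^sup>2 * (nat \<lceil>1 / u0\<rceil> + 1) + i" "m \<le> n" "n \<le> c" "c \<le> l"
    "l + seg i l \<le> m + seg L m" "w \<in> C" "dual (X (h c) - w) (x - w) \<le> 2 * nu4 / 3"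
    "\<And>j. j \<le> horizon (l + seg i l) \<Longrightarrow> dual (X j - w) (X j - x) \<le> p0"
proof -
  define l0 where "l0 = nat \<lceil>1 / u0\<rceil>"
  define D where "D = b\<^sup>2 * (l0 + 1)"
  define Z where "Z n = X (h n)" for n
  define V where "V = cheb_radius C Z"
  have "1 / u0 \<le> l0" unfolding l0_def by linarith
  then have "1 < u0 * (real l0 + 1)" using u0_pos by (simp add: pos_divide_le_eq algebra_simps)
  then have "1 / (real l0 + 1) < u0" by (simp add: pos_divide_less_eq)
  \<comment> \<open>The lower bound makes \<open>D\<close> drops of size \<open>d\<close> exceed
    \<open>b\<^sup>2\<close>; the upper one leaves the tolerance \<open>u0 - d\<close> for
    \<open>w\<close>.\<close>
  then obtain d where d: "1 / (real l0 + 1) < d" "d < u0" using dense by blast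
  have Z: "Z n \<in> C" for n by (simp add: Z_def X(1))
  have D: "(real b)\<^sup>2 < D * d"
  proof -
    have "0 < D" using b by (simp add: D_def)
    then have "D * (1 / (real l0 + 1)) < D * d" using d by (intro mult_strict_left_mono) auto
    moreover have "D * (1 / (real l0 + 1)) = (real b)\<^sup>2" by (simp add: D_def field_simps)
    ultimately show ?thesis by simp
  qed
  obtain \<kappa> where \<kappa>: "\<And>i m. \<exists>l. \<kappa> i m + seg i (m + \<kappa> i m) \<le> seg (Suc i) m \<and> m + seg i m \<le> l \<and>
      threshold 0 (l + seg i l) \<le> \<kappa> i m"
    using seg_tail by metis
  have "\<exists>i n. L \<le> D + i \<and> m \<le> n \<and> n + seg (Suc i) n \<le> m + seg L m \<and>
      V {n..n + seg (Suc i) n} \<le> V {n..n + seg i n} + d \<and>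
      V {n..n + seg (Suc i) n} \<le> V {n + \<kappa> i n..n + \<kappa> i n + seg i (n + \<kappa> i n)} + d"
  proof (rule stable_segment)
    show "0 \<le> V {m..n}" if "m \<le> n" for m n
      unfolding V_def using that x by (intro cheb_radius_nonneg) auto
    show "\<kappa> i m + seg i (m + \<kappa> i m) \<le> seg (Suc i) m" for i m using \<kappa> by blast
    show "D \<le> L" using L by (simp add: D_def l0_def)
    have "V {m..m + seg L m} \<le> (real b)\<^sup>2"
      unfolding V_def using x diff_le Z by (intro cheb_radius_upper) auto
    then show "V {m..m + seg L m} < D * d" using D by simp
  qed (rule seg_step)
  then obtain i n where i: "L \<le> D + i" "m \<le> n" "n + seg (Suc i) n \<le> m + seg L m"
    and VA: "V {n..n + seg (Suc i) n} \<le> V {n..n + seg i n} + d"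
    and VE: "V {n..n + seg (Suc i) n} \<le> V {n + \<kappa> i n..n + \<kappa> i n + seg i (n + \<kappa> i n)} + d"
    by blast
  obtain l where l: "\<kappa> i n + seg i (n + \<kappa> i n) \<le> seg (Suc i) n" "n + seg i n \<le> l"
      "threshold 0 (l + seg i l) \<le> \<kappa> i n"
    using \<kappa> by blast
  define N where "N = l + seg i l"
  define B where "B = {n..n + seg (Suc i) n}"
  define A where "A = {n..n + seg i n}"
  define E where "E = {n + \<kappa> i n..n + \<kappa> i n + seg i (n + \<kappa> i n)}"
  have fin: "finite B" "finite A" "finite E" "A \<noteq> {}" "E \<noteq> {}" by (auto simp: A_def B_def E_def)
  have sub: "A \<subseteq> B" "E \<subseteq> B" using l(1) seg_step[of i n] by (auto simp: A_def B_def E_def)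
  \<comment> \<open>By stability up to \<open>d\<close>, this \<open>w\<close> is a centre up to
    \<open>u0\<close> for both \<open>A\<close> and \<open>E\<close>.\<close>
  obtain w where w: "w \<in> C" "\<And>k. k \<in> B \<Longrightarrow> (norm (Z k - w))\<^sup>2 < V B + (u0 - d)"
    using cheb_radius_near[of B C "u0 - d" Z] fin x d unfolding V_def by auto
  obtain c where c: "c \<in> A" "V A \<le> (norm (Z c - (w + delta *\<^sub>R (x - w))))\<^sup>2"
    using cheb_radius_le[OF fin(2,4) towards_anchor_in[OF w(1)]] unfolding V_def by blast
  have "c \<in> B" using c sub by blast
  then have "dual (Z c - w) (x - w) \<le> 2 * nu4 / 3"
    using c w(2)[of c] VA unfolding A_def[symmetric] B_def[symmetric]
    by (intro anchor_inequality w(1) Z) auto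
  moreover have "dual (X j - w) (X j - x) \<le> p0" if j: "j \<le> horizon N" for j
  proof -
    define \<nu> where "\<nu> = nu1_star 0 N"
    have \<nu>: "0 < \<nu>" by (simp add: \<nu>_def nu1_star_pos)
    \<comment> \<open>\<open>\<nu> / 8\<close> serves \<open>centre_almost_fixed\<close>,
      \<open>u0\<close> the comparison of \<open>v\<close> with \<open>w\<close>.\<close>
    define e where "e = min (\<nu> / 8) u0"
    have e: "0 < e" "e \<le> \<nu> / 8" "e \<le> u0" using \<nu> u0_pos by (auto simp: e_def)
    obtain v where v: "v \<in> C" "\<And>k. k \<in> E \<Longrightarrow> (norm (Z k - v))\<^sup>2 < V E + e"
      using cheb_radius_near[of E C e Z] fin x e unfolding V_def by auto
    have "norm (w - v) < omega (p0 / (2 * real b))"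
    proof (rule centre_unique[OF fin(3,5) Z w(1) v(1)])
      show "(norm (Z k - w))\<^sup>2 \<le> cheb_radius C Z E + u0" if "k \<in> E" for k
        using w(2)[of k] sub that VE unfolding E_def[symmetric] B_def[symmetric] V_def[symmetric] by force
      show "(norm (Z k - v))\<^sup>2 \<le> cheb_radius C Z E + e" if "k \<in> E" for k
        using v(2)[OF that] by (simp add: V_def)
      have "0 < p0 / (2 * real b)" using p0_pos b by simp
      then show "0 < omega (p0 / (2 * real b))" by (rule omega_pos')
      have "u0 \<le> nu2" by (simp add: u0_def)
      then have "u0 + e < 4 * nu2" using e u0_pos by linarith
      then show "(u0 + e) / 2 < psi (omega (p0 / (2 * real b)))" by (simp add: nu2_def)
    qed
    moreover have "norm (T v - v) \<le> beta j"
    proof (rule centre_almost_fixed[OF fin(3,5) Z _ v(1) _ \<nu>])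
      show "norm (Z k - T (Z k)) \<le> \<nu> / (8 * real b)" if "k \<in> E" for k
      proof -
        have "threshold 0 N \<le> h k" using that l(3) h[of k] by (auto simp: E_def N_def)
        then show ?thesis unfolding Z_def \<nu>_def by (rule threshold_residual)
      qed
      show "(norm (Z k - v))\<^sup>2 \<le> cheb_radius C Z E + \<nu> / 8" if "k \<in> E" for k
        using v(2)[OF that] e by (simp add: V_def)
      show "2 * \<nu> \<le> psi (theta_tilde (beta j))"
        unfolding \<nu>_def using j by (intro nu1_star_le) (simp add: horizon_def)
    qed
    ultimately show ?thesis using v(1) w(1) by (intro approximant_inequality_near) auto
  qed
  \<comment> \<open>\<open>N\<close> is below its threshold, hence below \<open>\<kappa> i n\<close>
    and \<open>seg (Suc i) n\<close>.\<close>
  moreover have "N \<le> m + seg L m"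
    using threshold_ge[of N 0 N] l i by (simp add: N_def)
  moreover have "n \<le> c" "c \<le> l" using c l by (auto simp: A_def)
  ultimately show ?thesis
    using that[of i n c l w] i w(1) by (simp add: D_def l0_def N_def Z_def)
qed

section \<open>The contradiction between two good centres\<close>

lemma metastable:
  "\<exists>N\<le>Theta'. \<forall>m\<in>{N..N + g N}. \<forall>n\<in>{N..N + g N}. norm (X m - X n) \<le> 2 * \<epsilon>"
proof (rule ccontr)
  assume "\<not> ?thesis"
  then have bad: "\<exists>m\<in>{N..N + g N}. \<exists>n\<in>{N..N + g N}. 2 * \<epsilon> < norm (X m - X n)" if "N \<le> Theta'" for N
    using that by (meson not_le)
  define D where "D = b\<^sup>2 * (nat \<lceil>1 / u0\<rceil> + 1)"
  have I: "I (nat \<lceil>1 / u0\<rceil>) = 2 * D" by (simp add: I_def D_def)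
  obtain m0 where m0: "m0 + seg (2 * D) m0 \<le> Theta'" using Theta'_ge I by auto
  \<comment> \<open>First application, to \<open>X\<close> itself with all \<open>2 * D\<close>
    levels; it consumes at most \<open>D\<close> of them.\<close>
  have "D \<le> 2 * D" by simp
  then obtain i n l c w where 1: "2 * D \<le> D + i" "n \<le> c" "c \<le> l" "l + seg i l \<le> m0 + seg (2 * D) m0"
      "w \<in> C" "dual (X c - w) (x - w) \<le> 2 * nu4 / 3"
      and ineq: "\<And>j. j \<le> horizon (l + seg i l) \<Longrightarrow> dual (X j - w) (X j - x) \<le> p0"
    using good_centre[of "\<lambda>n. n" "2 * D" m0] unfolding D_def by (metis order_refl)
  have "\<exists>k\<in>{j..j + g j}. \<epsilon> < norm (X k - X c)" if j: "j \<le> Theta'" for j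
  proof (rule ccontr)
    assume far: "\<not> (\<exists>k\<in>{j..j + g j}. \<epsilon> < norm (X k - X c))"
    obtain k k' where k: "k \<in> {j..j + g j}" "k' \<in> {j..j + g j}" "2 * \<epsilon> < norm (X k - X k')"
      using bad[OF j] by blast
    have "norm (X k - X k') \<le> norm (X k - X c) + norm (X k' - X c)"
      using norm_triangle_ineq4[of "X k - X c" "X k' - X c"] by simp
    moreover have "norm (X k - X c) \<le> \<epsilon>" "norm (X k' - X c) \<le> \<epsilon>" using k(1,2) far by (meson not_le)+
    ultimately show False using k(3) by linarith
  qed
  \<comment> \<open>\<open>good_centre\<close> needs \<open>j \<le> h j\<close> for all
    \<open>j\<close>; beyond \<open>Theta'\<close> nothing else is asked of
    \<open>h\<close>.\<close>
  then have "\<exists>k. j \<le> k \<and> (j \<le> Theta' \<longrightarrow> k \<le> j + g j \<and> \<epsilon> < norm (X k - X c))" for j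
    by (cases "j \<le> Theta'") fastforce+
  then obtain h where h: "\<And>j. j \<le> h j"
      "\<And>j. j \<le> Theta' \<Longrightarrow> h j \<le> j + g j \<and> \<epsilon> < norm (X (h j) - X c)"
    by metis
  have "D \<le> i" using 1 by simp
  \<comment> \<open>Second application, inside the interval left by the first and with the remaining
    levels.\<close>
  then obtain i' n' l' c' w' where 2: "l \<le> n'" "n' \<le> c'" "c' \<le> l'" "l' + seg i' l' \<le> l + seg i l"
      "w' \<in> C" "dual (X (h c') - w') (x - w') \<le> 2 * nu4 / 3"
      and ineq': "\<And>j. j \<le> horizon (l' + seg i' l') \<Longrightarrow> dual (X j - w') (X j - x) \<le> p0"
    using good_centre[of h i l] h(1) unfolding D_def by metis
  have c': "c' \<le> Theta'" using 2 1 m0 by linarith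
  have horizon_mono: "horizon M \<le> horizon N" if "M \<le> N" for M N
    using that running_max_mono[OF that, of g] by (simp add: horizon_def)
  \<comment> \<open>The horizon includes the maximum of \<open>g\<close> so that \<open>h c'\<close>
    is covered by both families of inequalities.\<close>
  have "h c' \<le> horizon c'"
    using h(2)[OF c'] running_max_ge[of c' c' g] by (simp add: horizon_def)
  then have h_le: "h c' \<le> horizon (l' + seg i' l')" "h c' \<le> horizon (l + seg i l)"
    using horizon_mono[of c' "l' + seg i' l'"] horizon_mono[of c' "l + seg i l"] 2 by linarith+
  have c_le: "c \<le> horizon (l + seg i l)" "c \<le> horizon (l' + seg i' l')"
    using 1 2 by (auto simp: horizon_def)
  have "norm (X c - X (h c')) \<le> \<epsilon>"
    using 1 2 ineq ineq' h_le c_le by (intro centres_close[of w w'] near_centre) auto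
  then show False using h(2)[OF c'] by (simp add: norm_minus_commute)
qed

end

theorem theorem6p1:
  fixes \<eta> \<tau> \<theta> :: "real \<Rightarrow> real"
    and C :: "'a::banach set"
    and b :: nat
    and T :: "'a \<Rightarrow> 'a"
    and x :: 'a
    and xt :: "real \<Rightarrow> 'a"
    and t :: "nat \<Rightarrow> real"
    and \<alpha> \<gamma> :: "nat \<Rightarrow> nat"
  assumes "modulus_uniform_convexity TYPE('a) \<eta>"
    and "modulus_uniform_smoothness TYPE('a) \<tau>"
    and "closed C" and "convex C" and "C \<noteq> {}"
    and "b \<ge> 1"
    and "\<forall>y\<in>C. norm y \<le> real b"
    and "diameter C \<le> real b"
    and "pseudocontraction_on C T"
    and "modulus_uniform_continuity_on C T \<theta>"
    and "x \<in> C"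
    and "\<forall>s\<in>{0<..<1}. \<forall>z. (z \<in> C \<and> z = s *\<^sub>R T z + (1 - s) *\<^sub>R x) \<longleftrightarrow> z = xt s"
    and "\<forall>n. t n \<in> {0<..<1}"
    and "\<forall>n. \<gamma> n \<ge> 1"
    and "\<forall>n. \<forall>m\<ge>\<alpha> n. t m \<ge> 1 - 1 / (real n + 1)"
    and "\<forall>n. t n \<le> 1 - 1 / real (\<gamma> n)"
  shows "\<forall>\<epsilon>>0. \<forall>g :: nat \<Rightarrow> nat. \<exists>N\<le>Theta b \<eta> \<tau> \<theta> \<alpha> \<gamma> \<epsilon> g.
           \<forall>m\<in>{N..N + g N}. \<forall>n\<in>{N..N + g N}. norm (xt (t m) - xt (t n)) \<le> \<epsilon>"
proof (intro allI impI)
  fix \<epsilon> :: real and g :: "nat \<Rightarrow> nat"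
  assume eps: "0 < \<epsilon>"
  show "\<exists>N\<le>Theta b \<eta> \<tau> \<theta> \<alpha> \<gamma> \<epsilon> g.
      \<forall>m\<in>{N..N + g N}. \<forall>n\<in>{N..N + g N}. norm (xt (t m) - xt (t n)) \<le> \<epsilon>"
  proof (cases "\<exists>p :: 'a. norm p = 1")
    case True
    have fixed: "xt (t n) \<in> C \<and> xt (t n) = t n *\<^sub>R T (xt (t n)) + (1 - t n) *\<^sub>R x" for n
      using assms(12,13) by blast
    have "bounded C" using assms(7) by (auto simp: bounded_iff)
    then have "norm (y - z) \<le> b" if "y \<in> C" "z \<in> C" for y z
      using diameter_bounded_bound[of C y z] that assms(8) by (simp add: dist_norm)
    \<comment> \<open>The accuracy \<open>\<epsilon> / 2\<close> matches both the halving in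
      \<open>Theta\<close> and the factor \<open>2\<close> in \<open>metastable\<close>.\<close>
    then interpret pseudocontraction_approximants b \<eta> \<tau> \<theta> \<alpha> \<gamma> "\<epsilon> / 2" g C T x "\<lambda>n. xt (t n)" t
      using assms True eps fixed by unfold_locales auto
    show ?thesis using metastable by (simp add: Theta_def)
  next
    \<comment> \<open>The zero space has no unit vector, but all its distances vanish.\<close>
    case False
    have "y = 0" for y :: 'a
      using False by (metis norm_sgn)
    then have "norm (y - z) \<le> \<epsilon>" for y z :: 'a using eps by (metis norm_zero less_imp_le)
    then show ?thesis by blast
  qed
qed

end
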